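(* Let the problem data $f^{(1)},f^{(2)},g^{(1)},g^{(2)}$ satisfy the Basic Assumption, and consider proximal gradient iterations $x_{k+1}=\operatorname{prox}_{\alpha_{k+1}g_{k+1}}(x_k-\alpha_{k+1}\nabla f_{k+1}(x_k))$ as set up in the context. Suppose that there exist $\alpha_{\max}\ge\alpha_{\min}>0$ and $\nu\in(0,1)$ such that for every $k\in\mathbb N$: (a) $\alpha_{k+1}\le\min\{\widehat\alpha_{k+1},\alpha_{\max}\}$, with $\widehat\alpha_{k+1}$ as defined in the context (and well defined, i.e. the argument of the square root in its numerator is nonnegative); (b) $\alpha_{k+1}\ell_{k+1}\le\nu$; (c) $\alpha_{k+1}\ge\alpha_{\min}$; (d) $0<\sigma_{k+1}\le\sigma_k$; and (e) $\sigma_k\to0$ as $k\to\infty$ and $\sum_{k\in\mathbb N}\sigma_k=\infty$. Then: (i) $(x_k)_{k\in\mathbb N}$ is bounded and $\operatorname{dist}(x_k,\mathcal X_\star)\to0$ as $k\to\infty$. (ii) Both $\bar\varphi_k(x_k)$ and $W_k$ (defined in the context) converge to $0$ as $k\to\infty$, and for every $K\in\mathbb N$ $$\min_{0\le k\le K}\operatorname{dist}^2\bigl(0,\partial\varphi_{k+1}(x_{k+1})\bigr)\le\frac{(1+\alpha_{\max}L_{f_0,\mathcal V})^2}{\alpha_{\min}(1-\nu)(K+1)}\,\bar\varphi_0(x_0),$$ where $L_{f_0,\mathcal V}$ is a Lipschitz modulus of $\sigma_0\nabla f^{(1)}+\nabla f^{(2)}$ on $\mathcal V:=\operatorname{conv}\{x_k: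 k\in\mathbb N\}$.
   Context: Bilevel problem: minimize $\varphi^{(1)}(x)=f^{(1)}(x)+g^{(1)}(x)$ over $x\in\mathcal X^{(2)}=\operatorname{argmin}_{w\in\mathbb R^n}\varphi^{(2)}(w)$, where $\varphi^{(2)}=f^{(2)}+g^{(2)}$. Basic Assumption: (1) $f^{(1)},f^{(2)}:\mathbb R^n\to\mathbb R$ are convex and differentiable with locally Lipschitz-continuous gradients; (2) $g^{(1)},g^{(2)}:\mathbb R^n\to\mathbb R\cup\{\infty\}$ are proper, lower semicontinuous and convex; (3) $\bar\phi^{(1)}:=\inf_{x\in\operatorname{dom}\varphi^{(2)}}\varphi^{(1)}(x)>-\infty$; (4) the solution set $\mathcal X_\star:=\operatorname{argmin}\{\varphi^{(1)}(x): x\in\mathcal X^{(2)}\}$ is nonempty and bounded, the optimal value $\phi_\star:=\inf_{\mathcal X^{(2)}}\varphi^{(1)}$ being finite; in particular $\bar\phi^{(2)}:=\inf_{\mathbb R^n}\varphi^{(2)}>-\infty$. Iterations: $(\sigma_k)_{k\ge-1}$ and $(\alpha_k)_{k\ge-1}$ are strictly positive sequences with $\sigma_0\le\sigma_{-1}$; $f_k=\sigma_kf^{(1)}+f^{(2)}$, $g_k=\sigma_kg^{(1)}+g^{(2)}$, $\varphi_k=f_k+g_k$; $x_{-1}\in\mathbb R^n$ is arbitrary, $x_0=\operatorname{prox}_{\alpha_0g_0}(x_{-1}-\alpha_0\nabla f_0(x_{-1}))$, and $x_{k+1}=\operatorname{prox}_{\alpha_{k+1}g_{k+1}}(x_k-\alpha_{k+1}\nabla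 f_{k+1}(x_k))$ for $k\in\mathbb N$ ($\mathbb N\ni0$). Notation: $\operatorname{dom}h=\{x:h(x)<\infty\}$, $\operatorname{prox}_h(x)=\operatorname{argmin}_w\{h(w)+\tfrac12\|w-x\|^2\}$, $\partial$ is the convex subdifferential, $[t]_+=\max\{0,t\}$, $\operatorname{dist}(x,E)=\inf_{z\in E}\|z-x\|$. $\bar\varphi^{(i)}=\varphi^{(i)}-\bar\phi^{(i)}$ ($i=1,2$), $\bar\varphi_k=\sigma_k\bar\varphi^{(1)}+\bar\varphi^{(2)}$. With convention $0/0=0$, $$\ell_k=\frac{\langle\nabla f_k(x_{k-1})-\nabla f_k(x_k),x_{k-1}-x_k\rangle}{\|x_{k-1}-x_k\|^2},\quad L_k=\frac{\|\nabla f_k(x_{k-1})-\nabla f_k(x_k)\|}{\|x_{k-1}-x_k\|},\quad \ell_k^{(2)}=\frac{\langle\nabla f^{(2)}(x_{k-1})-\nabla f^{(2)}(x_k),x_{k-1}-x_k\rangle}{\|x_{k-1}-x_k\|^2}.$$ Further $\rho_k=\frac{\sigma_k\alpha_k}{\sigma_{k-1}\alpha_{k-1}}$, $\Delta_k=\frac1{\sigma_k}-\frac1{\sigma_{k-1}}$, $$\widehat\alpha_{k+1}=\frac{\sigma_k}{\sigma_{k+1}}\alpha_k\min\left\{\sqrt{\tfrac{\sigma_k}{\sigma_{k-1}}(1+\rho_k)},\ \frac{\sqrt{1-4\bigl(1-\tfrac{\sigma_k}{\sigma_{k-1}}\bigr)\alpha_k\ell_k^{(2)}}}{2\sqrt{[\alpha_k^2L_k^2-\alpha_k\ell_k]_+}}\right\}$$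 (the second element is $+\infty$ when $\alpha_k^2L_k^2-\alpha_k\ell_k\le0$), and $$W_k=\tfrac{1-4\alpha_k\sigma_k\ell_k^{(2)}\Delta_k}{4}\|x_k-x_{k-1}\|^2+\tfrac{\sigma_{k+1}}{\sigma_k}\alpha_{k+1}\rho_{k+1}\bar\varphi^{(2)}(x_{k-1})+\sigma_k\alpha_k\Delta_k\bar\varphi^{(2)}(x_k)+\sigma_k\alpha_k(1+\rho_k)\bigl(\varphi^{(1)}(x_{k-1})-\phi_\star\bigr).$$
   Formalization: If V has empty interior, the rate is stated only for L that are Lipschitz moduli on V of σ_k∇f¹+∇f² for every k (such L is shown to exist), since the bound can fail for a modulus of σ_0∇f¹+∇f² alone; if V has nonempty interior, every modulus of the latter is allowed. *)

theory Defs
  imports "HOL-Analysis.Analysis"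
begin

definition dom :: "('a \<Rightarrow> ereal) \<Rightarrow> 'a set" where
  "dom h = {x. h x < \<infinity>}"

definition proper :: "('a \<Rightarrow> ereal) \<Rightarrow> bool" where
  "proper h \<longleftrightarrow> (\<forall>x. h x \<noteq> -\<infinity>) \<and> dom h \<noteq> {}"

definition lsc :: "('a::topological_space \<Rightarrow> ereal) \<Rightarrow> bool" where
  "lsc h \<longleftrightarrow> (\<forall>x. h x \<le> Liminf (at x) h)"

(* Only used for functions that never take the value -infinity. *)
definition ext_convex :: "('a::real_vector \<Rightarrow> ereal) \<Rightarrow> bool" where
  "ext_convex h \<longleftrightarrow> (\<forall>x y u v. 0 \<le> u \<and> 0 \<le> v \<and> u + v = 1 \<longrightarrow>
     h (u *\<^sub>R x + v *\<^sub>R y) \<le> ereal u * h x + ereal v * h y)"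

definition argmin :: "'a set \<Rightarrow> ('a \<Rightarrow> ereal) \<Rightarrow> 'a set" where
  "argmin S h = {x. is_arg_min h (\<lambda>w. w \<in> S) x}"

(* Set of minimizers; a singleton whenever h is proper, lsc and convex. *)
definition prox :: "('a::real_inner \<Rightarrow> ereal) \<Rightarrow> 'a \<Rightarrow> 'a set" where
  "prox h x = argmin UNIV (\<lambda>w. h w + ereal (1/2 * (norm (w - x))\<^sup>2))"

definition subdifferential :: "('a::real_inner \<Rightarrow> ereal) \<Rightarrow> 'a \<Rightarrow> 'a set" where
  "subdifferential h x = {v. \<forall>y. h x + ereal (v \<bullet> (y - x)) \<le> h y}"

(* Extended-valued, so that the distance to the empty set is infinity
   (the library's infdist yields 0 there). *)
definition edist_set :: "'a::real_normed_vector \<Rightarrow> 'a set \<Rightarrow> ereal" where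
  "edist_set x E = (INF z\<in>E. ereal (norm (z - x)))"

definition grad :: "('a::real_inner \<Rightarrow> real) \<Rightarrow> 'a \<Rightarrow> 'a" where
  "grad f x = (THE v. GDERIV f x :> v)"

definition locally_lipschitz :: "('a::metric_space \<Rightarrow> 'b::metric_space) \<Rightarrow> bool" where
  "locally_lipschitz F \<longleftrightarrow> (\<forall>x. \<exists>u>0. \<exists>L. L-lipschitz_on (cball x u) F)"

definition composite :: "('a \<Rightarrow> real) \<Rightarrow> ('a \<Rightarrow> ereal) \<Rightarrow> 'a \<Rightarrow> ereal" where
  "composite f g x = ereal (f x) + g x"

definition lower_solutions :: "('a \<Rightarrow> real) \<Rightarrow> ('a \<Rightarrow> ereal) \<Rightarrow> 'a set" where
  "lower_solutions f2 g2 = argmin UNIV (composite f2 g2)"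

definition solutions ::
  "('a \<Rightarrow> real) \<Rightarrow> ('a \<Rightarrow> ereal) \<Rightarrow> ('a \<Rightarrow> real) \<Rightarrow> ('a \<Rightarrow> ereal) \<Rightarrow> 'a set" where
  "solutions f1 g1 f2 g2 = argmin (lower_solutions f2 g2) (composite f1 g1)"

definition opt_value ::
  "('a \<Rightarrow> real) \<Rightarrow> ('a \<Rightarrow> ereal) \<Rightarrow> ('a \<Rightarrow> real) \<Rightarrow> ('a \<Rightarrow> ereal) \<Rightarrow> ereal" where
  "opt_value f1 g1 f2 g2 = (INF x\<in>lower_solutions f2 g2. composite f1 g1 x)"

definition inf_upper ::
  "('a \<Rightarrow> real) \<Rightarrow> ('a \<Rightarrow> ereal) \<Rightarrow> ('a \<Rightarrow> real) \<Rightarrow> ('a \<Rightarrow> ereal) \<Rightarrow> ereal" where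
  "inf_upper f1 g1 f2 g2 = (INF x\<in>dom (composite f2 g2). composite f1 g1 x)"

definition inf_lower :: "('a \<Rightarrow> real) \<Rightarrow> ('a \<Rightarrow> ereal) \<Rightarrow> ereal" where
  "inf_lower f2 g2 = (INF x. composite f2 g2 x)"

definition basic_assumption ::
  "('a::real_inner \<Rightarrow> real) \<Rightarrow> ('a \<Rightarrow> ereal) \<Rightarrow> ('a \<Rightarrow> real) \<Rightarrow> ('a \<Rightarrow> ereal) \<Rightarrow> bool" where
  "basic_assumption f1 g1 f2 g2 \<longleftrightarrow>
     (\<forall>f\<in>{f1, f2}. convex_on UNIV f \<and> (\<forall>x. f differentiable (at x)) \<and> locally_lipschitz (grad f)) \<and>
     (\<forall>g\<in>{g1, g2}. proper g \<and> lsc g \<and> ext_convex g) \<and>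
     inf_upper f1 g1 f2 g2 > -\<infinity> \<and>
     solutions f1 g1 f2 g2 \<noteq> {} \<and> bounded (solutions f1 g1 f2 g2) \<and>
     \<bar>opt_value f1 g1 f2 g2\<bar> \<noteq> \<infinity>"

(* Penalized data for a single weight s, instantiated below with s = sigma k. *)

definition f_pen :: "('a \<Rightarrow> real) \<Rightarrow> ('a \<Rightarrow> real) \<Rightarrow> real \<Rightarrow> 'a \<Rightarrow> real" where
  "f_pen f1 f2 s x = s * f1 x + f2 x"

definition g_pen :: "('a \<Rightarrow> ereal) \<Rightarrow> ('a \<Rightarrow> ereal) \<Rightarrow> real \<Rightarrow> 'a \<Rightarrow> ereal" where
  "g_pen g1 g2 s x = ereal s * g1 x + g2 x"

definition phi_pen :: "('a \<Rightarrow> real) \<Rightarrow> ('a \<Rightarrow> ereal) \<Rightarrow> ('a \<Rightarrow> real) \<Rightarrow> ('a \<Rightarrow> ereal) \<Rightarrow>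
    real \<Rightarrow> 'a \<Rightarrow> ereal" where
  "phi_pen f1 g1 f2 g2 s = composite (f_pen f1 f2 s) (g_pen g1 g2 s)"

definition phi_bar1 :: "('a \<Rightarrow> real) \<Rightarrow> ('a \<Rightarrow> ereal) \<Rightarrow> ('a \<Rightarrow> real) \<Rightarrow> ('a \<Rightarrow> ereal) \<Rightarrow>
    'a \<Rightarrow> ereal" where
  "phi_bar1 f1 g1 f2 g2 x = composite f1 g1 x - inf_upper f1 g1 f2 g2"

definition phi_bar2 :: "('a \<Rightarrow> real) \<Rightarrow> ('a \<Rightarrow> ereal) \<Rightarrow> 'a \<Rightarrow> ereal" where
  "phi_bar2 f2 g2 x = composite f2 g2 x - inf_lower f2 g2"

definition phi_bar_pen :: "('a \<Rightarrow> real) \<Rightarrow> ('a \<Rightarrow> ereal) \<Rightarrow> ('a \<Rightarrow> real) \<Rightarrow> ('a \<Rightarrow> ereal) \<Rightarrow>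
    real \<Rightarrow> 'a \<Rightarrow> ereal" where
  "phi_bar_pen f1 g1 f2 g2 s x = ereal s * phi_bar1 f1 g1 f2 g2 x + phi_bar2 f2 g2 x"

(* Sequences are indexed by int and are only meaningful from index -1 on.
   Division by zero is zero, which is the convention 0/0 = 0 for the quotients below. *)

definition prox_grad_iterates ::
  "('a::real_inner \<Rightarrow> real) \<Rightarrow> ('a \<Rightarrow> ereal) \<Rightarrow> ('a \<Rightarrow> real) \<Rightarrow> ('a \<Rightarrow> ereal) \<Rightarrow>
   (int \<Rightarrow> real) \<Rightarrow> (int \<Rightarrow> real) \<Rightarrow> (int \<Rightarrow> 'a) \<Rightarrow> bool" where
  "prox_grad_iterates f1 g1 f2 g2 \<sigma> \<alpha> x \<longleftrightarrow>
     (\<forall>k\<ge>0. x k \<in> prox (\<lambda>w. ereal (\<alpha> k) * g_pen g1 g2 (\<sigma> k) w)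
                     (x (k - 1) - \<alpha> k *\<^sub>R grad (f_pen f1 f2 (\<sigma> k)) (x (k - 1))))"

definition curv :: "('a::real_inner \<Rightarrow> real) \<Rightarrow> 'a \<Rightarrow> 'a \<Rightarrow> real" where
  "curv f y z = ((grad f y - grad f z) \<bullet> (y - z)) / (norm (y - z))\<^sup>2"

definition lip_est :: "('a::real_inner \<Rightarrow> real) \<Rightarrow> 'a \<Rightarrow> 'a \<Rightarrow> real" where
  "lip_est f y z = norm (grad f y - grad f z) / norm (y - z)"

definition ell :: "('a::real_inner \<Rightarrow> real) \<Rightarrow> ('a \<Rightarrow> real) \<Rightarrow> (int \<Rightarrow> real) \<Rightarrow> (int \<Rightarrow> 'a) \<Rightarrow>
    int \<Rightarrow> real" where
  "ell f1 f2 \<sigma> x k = curv (f_pen f1 f2 (\<sigma> k)) (x (k - 1)) (x k)"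

definition Lk :: "('a::real_inner \<Rightarrow> real) \<Rightarrow> ('a \<Rightarrow> real) \<Rightarrow> (int \<Rightarrow> real) \<Rightarrow> (int \<Rightarrow> 'a) \<Rightarrow>
    int \<Rightarrow> real" where
  "Lk f1 f2 \<sigma> x k = lip_est (f_pen f1 f2 (\<sigma> k)) (x (k - 1)) (x k)"

definition ell2 :: "('a::real_inner \<Rightarrow> real) \<Rightarrow> (int \<Rightarrow> 'a) \<Rightarrow> int \<Rightarrow> real" where
  "ell2 f2 x k = curv f2 (x (k - 1)) (x k)"

definition rho :: "(int \<Rightarrow> real) \<Rightarrow> (int \<Rightarrow> real) \<Rightarrow> int \<Rightarrow> real" where
  "rho \<sigma> \<alpha> k = (\<sigma> k * \<alpha> k) / (\<sigma> (k - 1) * \<alpha> (k - 1))"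

definition Delta :: "(int \<Rightarrow> real) \<Rightarrow> int \<Rightarrow> real" where
  "Delta \<sigma> k = 1 / \<sigma> k - 1 / \<sigma> (k - 1)"

definition hat_numerator_arg ::
  "('a::real_inner \<Rightarrow> real) \<Rightarrow> (int \<Rightarrow> real) \<Rightarrow> (int \<Rightarrow> real) \<Rightarrow> (int \<Rightarrow> 'a) \<Rightarrow> int \<Rightarrow> real" where
  "hat_numerator_arg f2 \<sigma> \<alpha> x k = 1 - 4 * (1 - \<sigma> k / \<sigma> (k - 1)) * \<alpha> k * ell2 f2 x k"

definition hat_denominator_arg ::
  "('a::real_inner \<Rightarrow> real) \<Rightarrow> ('a \<Rightarrow> real) \<Rightarrow> (int \<Rightarrow> real) \<Rightarrow> (int \<Rightarrow> real) \<Rightarrow> (int \<Rightarrow> 'a) \<Rightarrow>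
   int \<Rightarrow> real" where
  "hat_denominator_arg f1 f2 \<sigma> \<alpha> x k = (\<alpha> k)\<^sup>2 * (Lk f1 f2 \<sigma> x k)\<^sup>2 - \<alpha> k * ell f1 f2 \<sigma> x k"

(* alpha_hat_next at k is the upper bound for the stepsize alpha (k + 1). *)
definition alpha_hat_next ::
  "('a::real_inner \<Rightarrow> real) \<Rightarrow> ('a \<Rightarrow> real) \<Rightarrow> (int \<Rightarrow> real) \<Rightarrow> (int \<Rightarrow> real) \<Rightarrow> (int \<Rightarrow> 'a) \<Rightarrow>
   int \<Rightarrow> ereal" where
  "alpha_hat_next f1 f2 \<sigma> \<alpha> x k =
     ereal (\<sigma> k / \<sigma> (k + 1) * \<alpha> k) *
     min (ereal (sqrt (\<sigma> k / \<sigma> (k - 1) * (1 + rho \<sigma> \<alpha> k))))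
         (if hat_denominator_arg f1 f2 \<sigma> \<alpha> x k \<le> 0 then \<infinity>
          else ereal (sqrt (hat_numerator_arg f2 \<sigma> \<alpha> x k) /
                      (2 * sqrt (max 0 (hat_denominator_arg f1 f2 \<sigma> \<alpha> x k)))))"

(* Extended-valued because composite f1 g1 and phi_bar2 may be infinite at the
   arbitrary starting point x (-1). *)
definition W :: "('a::real_inner \<Rightarrow> real) \<Rightarrow> ('a \<Rightarrow> ereal) \<Rightarrow> ('a \<Rightarrow> real) \<Rightarrow> ('a \<Rightarrow> ereal) \<Rightarrow>
    (int \<Rightarrow> real) \<Rightarrow> (int \<Rightarrow> real) \<Rightarrow> (int \<Rightarrow> 'a) \<Rightarrow> int \<Rightarrow> ereal" where
  "W f1 g1 f2 g2 \<sigma> \<alpha> x k =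
     ereal ((1 - 4 * \<alpha> k * \<sigma> k * ell2 f2 x k * Delta \<sigma> k) / 4 * (norm (x k - x (k - 1)))\<^sup>2)
     + ereal (\<sigma> (k + 1) / \<sigma> k * \<alpha> (k + 1) * rho \<sigma> \<alpha> (k + 1)) * phi_bar2 f2 g2 (x (k - 1))
     + ereal (\<sigma> k * \<alpha> k * Delta \<sigma> k) * phi_bar2 f2 g2 (x k)
     + ereal (\<sigma> k * \<alpha> k * (1 + rho \<sigma> \<alpha> k)) * (composite f1 g1 (x (k - 1)) - opt_value f1 g1 f2 g2)"

(* Lipschitz moduli L on V of s 0 * grad f1 + grad f2 (for V the convex hull of
   the iterates and s k the weights).  If V has nonempty interior, every such L is
   admitted; it is then automatically a modulus for all s k * grad f1 + grad f2 with
   0 \<le> s k \<le> s 0, as f1 and f2 are convex.  This fails if V lies in a proper affine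
   subspace: the modulus on V does not see how grad f1 and grad f2 cancel in directions
   normal to V (take f1(t,r) = (t - b r)^2 / 2, f2(t,r) = (t + b r)^2 / 2 and V inside the
   t-axis, with s 0 = 1), and the residual estimate can be false for such L.  In that case L is
   required to be a modulus on V for each of these maps. *)
definition modulus_on ::
  "('a::real_inner \<Rightarrow> real) \<Rightarrow> ('a \<Rightarrow> real) \<Rightarrow> (nat \<Rightarrow> real) \<Rightarrow> 'a set \<Rightarrow> real \<Rightarrow> bool" where
  "modulus_on f1 f2 s V L \<longleftrightarrow>
     L-lipschitz_on V (\<lambda>y. s 0 *\<^sub>R grad f1 y + grad f2 y) \<and>
     (interior V = {} \<longrightarrow> (\<forall>k. L-lipschitz_on V (\<lambda>y. s k *\<^sub>R grad f1 y + grad f2 y)))"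

end

theory Submission
  imports Defs
begin

text \<open>
  Two quantities control the iterates.

  The first is \<open>merit k\<close>, the penalized objective at \<open>x k\<close> with both levels shifted by their infima.  The optimality
  condition of a prox step provides a subgradient \<open>residual k\<close> of the penalized objective at \<open>x k\<close>, and the condition
  \<open>\<alpha> k * ell k \<le> \<nu>\<close> makes each step lower the merit value by at least \<open>(1 - \<nu>) / \<alpha> k\<close> times its squared length
  (\<open>merit_descent\<close>); the decreasing weights \<open>\<sigma> k\<close> can only lower it further.  Hence the steps tend to 0.  Since
  the residual is Lipschitz-bounded by the step, averaging the telescoping sum yields the rate (\<open>residual_rate\<close>).

  The second is the Lyapunov value \<open>U k = 1/2 * (norm (x k - z))\<^sup>2 + W k\<close> for a solution \<open>z\<close>.  By \<open>one_step\<close>,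
  \<open>U (k + 1) \<le> U k - c * upper_gap (k - 1)\<close>, where \<open>upper_gap (k - 1)\<close> is the upper objective at \<open>x (k - 1)\<close> minus the
  optimal value and the weights \<open>c = gap_weight k \<ge> 0\<close> have divergent sum.  The stepsize bound is made for this
  inequality.  The obstacle is that the upper gap can be negative, as the iterates are not feasible for the
  bilevel problem, so \<open>U\<close> need not decrease.  But whenever the upper gap is at most a constant, \<open>x (k - 1)\<close> is
  almost optimal for both levels and lies in a \<open>sublevel\<close> set.  Because the solution set is bounded, these convex sets
  are bounded (\<open>bounded_sublevel\<close>), and inside a ball they shrink to the solution set
  (\<open>sublevel_near_solutions\<close>).  So at every index either \<open>U\<close> decreases or the iterate is under control anyway.  With a
  fixed level this dichotomy bounds the iterates (\<open>iterates_bounded\<close>).  Boundedness and convexity then force the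
  merit values, and with them \<open>W k\<close>, to 0.  With a small level and the divergent sum of the weights, the
  same dichotomy brings the distance to the solution set to 0 (\<open>infdist_tendsto_0\<close>).

  The rate is stated with a modulus for the gradient at the largest weight \<open>\<sigma> 0\<close>.  If \<open>V\<close> has interior points, it
  serves for all smaller weights: the quadratic upper model of a convex function survives the removal of a convex
  summand and, together with convexity, bounds the variation of the gradient as in the Baillon--Haddad theorem
  (\<open>lipschitz_grad_f_pen_mono\<close>).
\<close>

section \<open>Gradients of convex functions\<close>

lemma GDERIV_unique:
  assumes "GDERIV f x :> D" "GDERIV f x :> D'"
  shows "D = D'"
proof -
  have "(\<lambda>h. h \<bullet> D) = (\<lambda>h. h \<bullet> D')"
    using assms unfolding gderiv_def by (rule has_derivative_unique)
  then show ?thesis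
    by (metis vector_eq_ldot)
qed

lemma grad_eqI: "GDERIV f x :> D \<Longrightarrow> grad f x = D"
  unfolding grad_def by (rule the_equality) (auto intro: GDERIV_unique)

text \<open>
  Riesz representation: the derivative is the inner product with the image of 1 under its adjoint, so the
  description that defines \<open>grad\<close> picks out an actual gradient.
\<close>

lemma GDERIV_grad:
  fixes f :: "'a::euclidean_space \<Rightarrow> real"
  assumes "f differentiable (at x)"
  shows "GDERIV f x :> grad f x"
proof -
  obtain f' where f': "(f has_derivative f') (at x)"
    using assms unfolding differentiable_def by blast
  have lin: "linear f'"
    using f' by (simp add: bounded_linear.linear has_derivative_bounded_linear)
  have "f' = (\<lambda>h. h \<bullet> adjoint f' 1)"
    by (simp add: adjoint_works[OF lin])
  then have "GDERIV f x :> adjoint f' 1"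
    unfolding gderiv_def using f' by simp
  with grad_eqI[OF this] show ?thesis by simp
qed

lemma GDERIV_f_pen:
  assumes "GDERIV f1 x :> G1" "GDERIV f2 x :> G2"
  shows "GDERIV (f_pen f1 f2 s) x :> s *\<^sub>R G1 + G2"
proof -
  have "((\<lambda>y. s * f1 y + f2 y) has_derivative (\<lambda>h. s * (h \<bullet> G1) + h \<bullet> G2)) (at x)"
    using assms unfolding gderiv_def by (auto intro!: derivative_eq_intros)
  then show ?thesis
    unfolding gderiv_def f_pen_def by (simp add: inner_add_right)
qed

lemma has_real_derivative_along_ray:
  assumes "GDERIV f (x + t *\<^sub>R d) :> G"
  shows "((\<lambda>t. f (x + t *\<^sub>R d)) has_real_derivative d \<bullet> G) (at t)"
proof -
  have 1: "((\<lambda>t. x + t *\<^sub>R d) has_derivative (\<lambda>h. h *\<^sub>R d)) (at t)"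
    by (auto intro!: derivative_eq_intros)
  have "((\<lambda>t. f (x + t *\<^sub>R d)) has_derivative (\<lambda>h. (h *\<^sub>R d) \<bullet> G)) (at t)"
    using has_derivative_compose[OF 1 assms[unfolded gderiv_def]] .
  then show ?thesis
    unfolding has_field_derivative_def by (simp add: mult.commute[of _ "d \<bullet> G"] fun_eq_iff mult_commute_abs)
qed

text \<open>
  Restricted to the line through \<open>x\<close> and \<open>y\<close> this is the tangent inequality for convex functions of one real
  variable.
\<close>

lemma convex_above_tangent:
  assumes "convex_on UNIV f" "GDERIV f x :> G"
  shows "f x + G \<bullet> (y - x) \<le> f y"
proof -
  define q where "q = (\<lambda>t. f (x + t *\<^sub>R (y - x)))"
  have q': "(q has_real_derivative (y - x) \<bullet> G) (at 0)"
    unfolding q_def by (rule has_real_derivative_along_ray) (use assms(2) in simp)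
  have "convex_on UNIV q"
  proof (rule convex_onI)
    fix t a b :: real assume t: "0 < t" "t < 1"
    have "x + ((1 - t) *\<^sub>R a + t *\<^sub>R b) *\<^sub>R (y - x)
      = (1 - t) *\<^sub>R (x + a *\<^sub>R (y - x)) + t *\<^sub>R (x + b *\<^sub>R (y - x))"
      by (simp add: algebra_simps)
    then show "q ((1 - t) *\<^sub>R a + t *\<^sub>R b) \<le> (1 - t) * q a + t * q b"
      unfolding q_def using convex_onD[OF assms(1), of t] t by simp
  qed simp
  then have "q 1 - q 0 \<ge> ((y - x) \<bullet> G) * (1 - 0)"
    by (rule convex_on_imp_above_tangent[where A = UNIV]) (use q' in auto)
  then show ?thesis by (simp add: q_def inner_commute)
qed

lemma grad_monotone:
  fixes f :: "'a::euclidean_space \<Rightarrow> real"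
  assumes "convex_on UNIV f" "\<And>x. f differentiable (at x)"
  shows "0 \<le> (grad f y - grad f z) \<bullet> (y - z)"
  using convex_above_tangent[OF assms(1) GDERIV_grad[OF assms(2)], of y z]
    convex_above_tangent[OF assms(1) GDERIV_grad[OF assms(2)], of z y]
  by (simp add: inner_diff_left inner_diff_right inner_commute)

lemma curv_nonneg:
  fixes f :: "'a::euclidean_space \<Rightarrow> real"
  assumes "convex_on UNIV f" "\<And>x. f differentiable (at x)"
  shows "0 \<le> curv f y z"
  unfolding curv_def using grad_monotone[OF assms] by simp

text \<open>
  The products undo the division also for coinciding points, where both sides vanish; with them the
  quotients never have to be treated by cases again.
\<close>

lemma curv_mult_norm: "curv f y z * (norm (y - z))\<^sup>2 = (grad f y - grad f z) \<bullet> (y - z)"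
  unfolding curv_def by (cases "y = z") auto

lemma lip_est_mult_norm: "(lip_est f y z)\<^sup>2 * (norm (y - z))\<^sup>2 = (norm (grad f y - grad f z))\<^sup>2"
  unfolding lip_est_def by (cases "y = z") (auto simp: power_divide)

lemma compact_locally_lipschitz:
  fixes F :: "'a::metric_space \<Rightarrow> 'b::metric_space"
  assumes "locally_lipschitz F" "compact S"
  obtains L where "L-lipschitz_on S F"
proof -
  have "local_lipschitz {0::real} S (\<lambda>_. F)"
  proof (rule local_lipschitzI)
    fix t x assume "t \<in> {0::real}" "x \<in> S"
    obtain u L where "u > 0" "L-lipschitz_on (cball x u) F"
      using assms(1) unfolding locally_lipschitz_def by blast
    then have "\<forall>t\<in>cball t u \<inter> {0}. L-lipschitz_on (cball x u \<inter> S) F"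
      by (meson inf_le1 lipschitz_on_subset)
    with \<open>u > 0\<close> show "\<exists>u>0. \<exists>L. \<forall>t\<in>cball t u \<inter> {0}. L-lipschitz_on (cball x u \<inter> S) F"
      by blast
  qed
  then obtain L where "L-lipschitz_on S F"
    using local_lipschitz_compact_implies_lipschitz[OF _ assms(2), of "{0::real}" "\<lambda>_. F"] by auto
  then show thesis by (rule that)
qed

lemma locally_lipschitz_isCont:
  assumes "locally_lipschitz F"
  shows "isCont F x"
proof -
  obtain u L where "u > 0" and L: "L-lipschitz_on (cball x u) F"
    using assms unfolding locally_lipschitz_def by blast
  then have "continuous_on (ball x u) F"
    using lipschitz_on_continuous_on continuous_on_subset ball_subset_cball by blast
  then show ?thesis
    using \<open>u > 0\<close> continuous_on_eq_continuous_at open_ball centre_in_ball by blast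
qed

text \<open>
  On the segment from \<open>x\<close> to \<open>y\<close>, which stays in \<open>V\<close>, the difference between \<open>h\<close> and the quadratic model is
  nonincreasing, because its derivative is bounded by the Lipschitz estimate for the gradient.
\<close>

lemma descent_lemma:
  fixes h :: "'a::real_inner \<Rightarrow> real"
  assumes h: "\<And>x. GDERIV h x :> H x" and L: "L-lipschitz_on V H"
    and V: "convex V" "x \<in> V" "y \<in> V"
  shows "h y \<le> h x + H x \<bullet> (y - x) + L / 2 * (norm (y - x))\<^sup>2"
proof -
  define d where "d = y - x"
  define q where "q = (\<lambda>t. h (x + t *\<^sub>R d) - t * (H x \<bullet> d) - L / 2 * t\<^sup>2 * (norm d)\<^sup>2)"
  have "q 1 \<le> q 0"
  proof (rule DERIV_nonpos_imp_nonincreasing[of 0 1 q])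
    fix t :: real assume t: "0 \<le> t" "t \<le> 1"
    have "(q has_real_derivative d \<bullet> H (x + t *\<^sub>R d) - H x \<bullet> d - L * t * (norm d)\<^sup>2) (at t)"
      unfolding q_def by (auto intro!: derivative_eq_intros has_real_derivative_along_ray h)
    moreover have "d \<bullet> H (x + t *\<^sub>R d) - H x \<bullet> d - L * t * (norm d)\<^sup>2 \<le> 0"
    proof -
      have "x + t *\<^sub>R d = (1 - t) *\<^sub>R x + t *\<^sub>R y"
        by (simp add: d_def algebra_simps)
      then have "x + t *\<^sub>R d \<in> V"
        using convexD_alt[OF V t] by simp
      then have "dist (H (x + t *\<^sub>R d)) (H x) \<le> L * dist (x + t *\<^sub>R d) x"
        using lipschitz_onD[OF L] V by blast
      then have "norm (H (x + t *\<^sub>R d) - H x) \<le> L * (t * norm d)"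
        using t by (simp add: dist_norm)
      then have "norm (H (x + t *\<^sub>R d) - H x) * norm d \<le> L * (t * norm d) * norm d"
        by (rule mult_right_mono) simp
      moreover have "(H (x + t *\<^sub>R d) - H x) \<bullet> d \<le> norm (H (x + t *\<^sub>R d) - H x) * norm d"
        by (rule norm_cauchy_schwarz)
      ultimately have "(H (x + t *\<^sub>R d) - H x) \<bullet> d \<le> L * (t * norm d) * norm d"
        by linarith
      then show ?thesis
        by (simp add: inner_diff_left inner_commute power2_eq_square algebra_simps)
    qed
    ultimately show "\<exists>y. (q has_real_derivative y) (at t) \<and> y \<le> 0" by blast
  qed simp
  then show ?thesis by (simp add: q_def d_def)
qed

section \<open>Lipschitz moduli of penalized gradients\<close>

lemma GDERIV_isCont: "GDERIV f x :> G \<Longrightarrow> isCont f x"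
  unfolding gderiv_def by (rule has_derivative_continuous)

text \<open>
  The Baillon--Haddad argument: \<open>k\<close> minus its linear part at \<open>w\<close> is minimal at \<open>w\<close>, while a gradient step of length
  \<open>1 / M\<close> from \<open>u\<close> lowers it by \<open>(norm (K u - K w))\<^sup>2 / (2 * M)\<close>.  The quadratic upper model is demanded only at the
  end point of that step, so that the lemma applies when the model is known only locally.
\<close>

lemma gradient_diff_le_Bregman:
  fixes k :: "'a::real_inner \<Rightarrow> real"
  assumes tangent: "\<And>u w. k u + K u \<bullet> (w - u) \<le> k w"
    and upper: "k (u - (1/M) *\<^sub>R (K u - K w)) \<le> k u + K u \<bullet> ((u - (1/M) *\<^sub>R (K u - K w)) - u)
        + M / 2 * (norm ((u - (1/M) *\<^sub>R (K u - K w)) - u))\<^sup>2"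
    and "M > 0"
  shows "(norm (K u - K w))\<^sup>2 / (2 * M) \<le> k u - k w - K w \<bullet> (u - w)"
proof -
  define d where "d = K u - K w"
  define z where "z = u - (1/M) *\<^sub>R d"
  have "k w + K w \<bullet> (z - w) \<le> k z" by (rule tangent)
  also have "k z \<le> k u + K u \<bullet> (z - u) + M / 2 * (norm (z - u))\<^sup>2"
    using upper by (simp add: z_def d_def)
  also have "(norm (z - u))\<^sup>2 = (norm d)\<^sup>2 / M\<^sup>2"
    by (simp add: z_def power_divide)
  finally have "k w + K w \<bullet> (z - w) \<le> k u + K u \<bullet> (z - u) + (norm d)\<^sup>2 / (2 * M)"
    using \<open>M > 0\<close> by (simp add: power2_eq_square)
  moreover have "K w \<bullet> (z - w) = K w \<bullet> (z - u) + K w \<bullet> (u - w)"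
    by (simp add: inner_diff_right)
  moreover have "K u \<bullet> (z - u) - K w \<bullet> (z - u) = d \<bullet> (z - u)"
    by (simp add: d_def inner_diff_left)
  moreover have "d \<bullet> (z - u) = - (norm d)\<^sup>2 / M"
    by (simp add: z_def power2_norm_eq_inner)
  ultimately show ?thesis
    unfolding d_def[symmetric] by (simp add: field_simps)
qed

text \<open>
  Around an interior point the gradient step of the previous lemma remains in \<open>V\<close>, because \<open>K\<close> is continuous.  Adding
  the two Bregman estimates and applying Cauchy--Schwarz gives the modulus \<open>M\<close> locally, and a local modulus
  propagates along segments.  Taking \<open>M\<close> strictly above \<open>L\<close> keeps the step length \<open>1 / M\<close> meaningful for \<open>L = 0\<close>.
\<close>

lemma gradient_lipschitz_interior:
  fixes k :: "'a::euclidean_space \<Rightarrow> real"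
  assumes tangent: "\<And>u w. k u + K u \<bullet> (w - u) \<le> k w"
    and upper: "\<And>u w. u \<in> V \<Longrightarrow> w \<in> V \<Longrightarrow> k w \<le> k u + K u \<bullet> (w - u) + L / 2 * (norm (w - u))\<^sup>2"
    and cont: "\<And>u. isCont K u"
    and V: "convex V" and M: "M > L" "L \<ge> 0"
  shows "M-lipschitz_on (interior V) K"
proof (rule lipschitz_onI)
  have "M > 0" using M by simp
  then show "0 \<le> M" by simp
  have upperM: "k w \<le> k u + K u \<bullet> (w - u) + M / 2 * (norm (w - u))\<^sup>2"
    if "u \<in> V" "w \<in> V" for u w
  proof -
    have "L / 2 * (norm (w - u))\<^sup>2 \<le> M / 2 * (norm (w - u))\<^sup>2"
      using M by (intro mult_right_mono) auto
    with upper[OF that] show ?thesis by linarith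
  qed
  have local: "\<exists>e>0. \<forall>w. norm (w - u) < e \<longrightarrow> norm (K u - K w) \<le> M * norm (u - w)"
    if "u \<in> interior V" for u
  proof -
    obtain r where r: "r > 0" "ball u r \<subseteq> V"
      using \<open>u \<in> interior V\<close> mem_interior by blast
    obtain e' where e': "e' > 0" "\<And>w. dist w u < e' \<Longrightarrow> dist (K w) (K u) < M * (r / 2)"
    proof -
      have "M * (r / 2) > 0" using r \<open>M > 0\<close> by simp
      then show thesis
        using cont[of u] that unfolding continuous_at_eps_delta by blast
    qed
    \<comment> \<open>gradient steps of length \<open>1 / M\<close> from \<open>u\<close> and from \<open>w\<close> then end inside the ball of radius \<open>r\<close>\<close>
    define e where "e = min e' (r / 2)"
    have "norm (K u - K w) \<le> M * norm (u - w)" if w: "norm (w - u) < e" for w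
    proof (cases "K u = K w")
      case True
      then show ?thesis using \<open>M > 0\<close> by simp
    next
      case False
      have small: "norm (K u - K w) / M < r / 2"
        using e'(2)[of w] w \<open>M > 0\<close> by (simp add: e_def dist_norm norm_minus_commute field_simps)
      have w_ball: "norm (w - u) < r / 2" using w by (simp add: e_def)
      have in_V: "v \<in> V" if "norm (v - u) < r" for v
        using r that by (auto simp: subset_iff dist_norm norm_minus_commute)
      have uV: "u \<in> V" using in_V[of u] r by simp
      have wV: "w \<in> V" using in_V w_ball r by simp
      have z1: "u - (1/M) *\<^sub>R (K u - K w) \<in> V"
      proof (rule in_V)
        have "norm (K u - K w) / M < r" using small r by linarith
        then show "norm (u - (1/M) *\<^sub>R (K u - K w) - u) < r"
          using \<open>M > 0\<close> by simp
      qed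
      have z2: "w - (1/M) *\<^sub>R (K w - K u) \<in> V"
      proof (rule in_V)
        have "norm (w - (1/M) *\<^sub>R (K w - K u) - u) \<le> norm (w - u) + norm ((1/M) *\<^sub>R (K w - K u))"
          using norm_triangle_ineq4[of "w - u" "(1/M) *\<^sub>R (K w - K u)"]
          by (simp only: diff_diff_eq add.commute)
        also have "norm ((1/M) *\<^sub>R (K w - K u)) = norm (K u - K w) / M"
          using \<open>M > 0\<close> by (simp add: norm_minus_commute)
        finally show "norm (w - (1/M) *\<^sub>R (K w - K u) - u) < r"
          using small w_ball by linarith
      qed
      have 1: "(norm (K u - K w))\<^sup>2 / (2 * M) \<le> k u - k w - K w \<bullet> (u - w)"
        by (rule gradient_diff_le_Bregman[OF tangent upperM[OF uV z1] \<open>M > 0\<close>])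
      have 2: "(norm (K w - K u))\<^sup>2 / (2 * M) \<le> k w - k u - K u \<bullet> (w - u)"
        by (rule gradient_diff_le_Bregman[OF tangent upperM[OF wV z2] \<open>M > 0\<close>])
      have "(norm (K u - K w))\<^sup>2 / M \<le> (K u - K w) \<bullet> (u - w)"
        using 1 2 by (simp add: norm_minus_commute inner_diff_left inner_diff_right)
      also have "\<dots> \<le> norm (K u - K w) * norm (u - w)"
        by (rule norm_cauchy_schwarz)
      finally show ?thesis
        using False \<open>M > 0\<close> by (simp add: power2_eq_square field_simps)
    qed
    moreover have "e > 0" using e' r by (simp add: e_def)
    ultimately show ?thesis by blast
  qed
  fix a b assume ab: "a \<in> interior V" "b \<in> interior V"
  define p where "p = (\<lambda>t::real. a + t *\<^sub>R (b - a))"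
  have p_in: "p t \<in> interior V" if "0 \<le> t" "t \<le> 1" for t
  proof -
    have "p t = (1 - t) *\<^sub>R a + t *\<^sub>R b" by (simp add: p_def algebra_simps)
    then show ?thesis
      using convexD_alt[OF convex_interior[OF V] ab that] by simp
  qed
  have "dist ((K \<circ> p) 1) ((K \<circ> p) 0) \<le> (M * norm (b - a)) * (1 - 0)"
  proof (rule locally_lipschitz_imp_lipschitz_aux)
    show "continuous_on {0..1} (K \<circ> p)"
      unfolding p_def
      by (intro continuous_on_compose continuous_intros continuous_at_imp_continuous_on ballI cont)
  next
    fix t :: real assume t: "t \<in> {0..<1}"
    obtain e where e: "e > 0" "\<And>w. norm (w - p t) < e \<Longrightarrow> norm (K (p t) - K w) \<le> M * norm (p t - w)"
      using local[OF p_in[of t]] t by auto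
    define h where "h = min (1 - t) (e / (2 * (norm (b - a) + 1)))"
    have h: "h > 0" using t e(1) by (auto simp: h_def intro!: divide_pos_pos add_nonneg_pos)
    have diff: "p (t + h) - p t = h *\<^sub>R (b - a)"
      by (simp add: p_def algebra_simps)
    have "h * norm (b - a) \<le> (e / (2 * (norm (b - a) + 1))) * norm (b - a)"
      by (intro mult_right_mono) (auto simp: h_def)
    also have "\<dots> < e"
    proof -
      have "norm (b - a) < 2 * (norm (b - a) + 1)"
        by (smt (verit) norm_ge_zero)
      then show ?thesis
        using e(1) by (simp add: divide_less_eq add_nonneg_pos)
    qed
    finally have "norm (p (t + h) - p t) < e"
      using h by (simp add: diff)
    from e(2)[OF this] have "norm (K (p (t + h)) - K (p t)) \<le> M * norm (p (t + h) - p t)"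
      by (simp only: norm_minus_commute)
    then have "dist ((K \<circ> p) (t + h)) ((K \<circ> p) t) \<le> M * (h * norm (b - a))"
      using h by (simp add: dist_norm diff)
    then show "\<exists>y\<in>{t<..1}. dist ((K \<circ> p) y) ((K \<circ> p) t) \<le> M * norm (b - a) * (y - t)"
      using h by (intro bexI[of _ "t + h"]) (auto simp: h_def algebra_simps)
  qed simp
  then show "dist (K a) (K b) \<le> M * dist a b"
    by (simp add: p_def dist_norm norm_minus_commute)
qed

text \<open>
  Lowering the weight of \<open>f1\<close> from \<open>s0\<close> to \<open>s\<close> removes a nonnegative Bregman distance, that of \<open>(s0 - s) f1\<close>, so
  the quadratic upper model with constant \<open>L\<close> survives, and convexity supplies the lower model.  These two-sided
  bounds control the full gradient difference only if points of \<open>V\<close> may be moved in its direction, which is where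
  the nonempty interior enters; the boundary of \<open>V\<close> is reached by continuity.
\<close>

lemma lipschitz_grad_f_pen_mono:
  fixes f1 f2 :: "'a::euclidean_space \<Rightarrow> real"
  assumes f: "convex_on UNIV f1" "convex_on UNIV f2"
      "\<And>x. f1 differentiable (at x)" "\<And>x. f2 differentiable (at x)"
    and cont: "\<And>x. isCont (grad f1) x" "\<And>x. isCont (grad f2) x"
    and V: "convex V" "interior V \<noteq> {}"
    and L: "L-lipschitz_on V (\<lambda>y. s0 *\<^sub>R grad f1 y + grad f2 y)"
    and s: "0 \<le> s" "s \<le> s0"
  shows "L-lipschitz_on V (\<lambda>y. s *\<^sub>R grad f1 y + grad f2 y)"
proof -
  define K where "K = (\<lambda>y. s *\<^sub>R grad f1 y + grad f2 y)"
  note G1 = GDERIV_grad[OF f(3)] and G2 = GDERIV_grad[OF f(4)]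
  note t1 = convex_above_tangent[OF f(1) G1] and t2 = convex_above_tangent[OF f(2) G2]
  have "L \<ge> 0" using L by (rule lipschitz_on_nonneg)
  have contK: "isCont K u" for u
    unfolding K_def by (intro continuous_intros cont)
  have tangent: "f_pen f1 f2 s u + K u \<bullet> (w - u) \<le> f_pen f1 f2 s w" for u w
    using mult_left_mono[OF t1 s(1), of u w] t2[of u w]
    by (simp add: f_pen_def K_def inner_add_left algebra_simps)
  have upper: "f_pen f1 f2 s w \<le> f_pen f1 f2 s u + K u \<bullet> (w - u) + L / 2 * (norm (w - u))\<^sup>2"
    if "u \<in> V" "w \<in> V" for u w
  proof -
    have "(s0 - s) * (f1 u + grad f1 u \<bullet> (w - u)) \<le> (s0 - s) * f1 w"
      using t1 s by (intro mult_left_mono) auto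
    moreover have "f_pen f1 f2 s0 w \<le> f_pen f1 f2 s0 u
        + (s0 *\<^sub>R grad f1 u + grad f2 u) \<bullet> (w - u) + L / 2 * (norm (w - u))\<^sup>2"
      by (rule descent_lemma[OF GDERIV_f_pen[OF G1 G2] L V(1) that])
    ultimately show ?thesis
      by (simp add: f_pen_def K_def inner_add_left algebra_simps)
  qed
  have "L-lipschitz_on (interior V) K"
  proof (rule lipschitz_onI)
    fix a b assume ab: "a \<in> interior V" "b \<in> interior V"
    show "dist (K a) (K b) \<le> L * dist a b"
    proof (cases "a = b")
      case False
      show ?thesis
      proof (rule field_le_epsilon)
        fix e :: real assume "e > 0"
        \<comment> \<open>a modulus above \<open>L\<close> that costs only \<open>e\<close> at this pair of points\<close>
        define M where "M = L + e / dist a b"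
        have "M > L" using False \<open>e > 0\<close> by (simp add: M_def)
        then have "M-lipschitz_on (interior V) K"
          using gradient_lipschitz_interior[OF tangent upper contK V(1)] \<open>L \<ge> 0\<close> by blast
        from lipschitz_onD[OF this ab] show "dist (K a) (K b) \<le> L * dist a b + e"
          using False by (simp add: M_def distrib_right)
      qed
    qed simp
  qed fact
  then have "L-lipschitz_on (closure (interior V)) K"
    by (rule lipschitz_on_closure) (simp add: continuous_at_imp_continuous_on contK)
  then show ?thesis
    unfolding convex_closure_interior[OF V] K_def
    by (rule lipschitz_on_subset) (rule closure_subset)
qed

section \<open>Extended-valued convex functions and the proximal map\<close>

lemma ext_convexD:
  assumes "ext_convex h" "0 \<le> u" "0 \<le> v" "u + v = 1"
  shows "h (u *\<^sub>R x + v *\<^sub>R y) \<le> ereal u * h x + ereal v * h y"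
  using assms unfolding ext_convex_def by blast

lemma convex_dom:
  assumes "ext_convex h" shows "convex (dom h)"
proof (rule convexI)
  fix x y and u v :: real
  assume "x \<in> dom h" "y \<in> dom h" and uv: "0 \<le> u" "0 \<le> v" "u + v = 1"
  then have "h x < \<infinity>" "h y < \<infinity>" by (auto simp: dom_def)
  with uv have "ereal u * h x + ereal v * h y < \<infinity>"
    by (cases "h x"; cases "h y") (auto simp: ereal_mult_less_0_iff)
  with ext_convexD[OF assms uv, of x y] show "u *\<^sub>R x + v *\<^sub>R y \<in> dom h"
    unfolding dom_def by (metis le_less_trans mem_Collect_eq)
qed

lemma proper_finite:
  assumes "proper h" "x \<in> dom h"
  shows "h x = ereal (real_of_ereal (h x))"
  using assms unfolding proper_def dom_def by (cases "h x") auto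

lemma convex_on_real_of_ereal:
  assumes "proper h" "ext_convex h"
  shows "convex_on (dom h) (\<lambda>x. real_of_ereal (h x))"
  unfolding convex_on_def
proof (intro conjI ballI allI impI)
  show "convex (dom h)" by (rule convex_dom) fact
  fix x y and u v :: real
  assume xy: "x \<in> dom h" "y \<in> dom h" and uv: "0 \<le> u" "0 \<le> v" "u + v = 1"
  then have "u *\<^sub>R x + v *\<^sub>R y \<in> dom h"
    using convexD[OF convex_dom[OF assms(2)]] by blast
  note fin = proper_finite[OF assms(1) this] proper_finite[OF assms(1) xy(1)]
    proper_finite[OF assms(1) xy(2)]
  have "ereal (real_of_ereal (h (u *\<^sub>R x + v *\<^sub>R y)))
      \<le> ereal u * ereal (real_of_ereal (h x)) + ereal v * ereal (real_of_ereal (h y))"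
    using ext_convexD[OF assms(2) uv, of x y] fin by metis
  then show "real_of_ereal (h (u *\<^sub>R x + v *\<^sub>R y))
      \<le> u * real_of_ereal (h x) + v * real_of_ereal (h y)"
    by simp
qed

text \<open>
  If \<open>f x + g x > c\<close>, a real number strictly between \<open>c - f x\<close> and \<open>g x\<close> separates the contributions of \<open>f\<close> and
  \<open>g\<close>: the first stays on its side by continuity, the second by lower semicontinuity.
\<close>

lemma closed_sublevel_composite:
  fixes f :: "'a::t2_space \<Rightarrow> real"
  assumes cont: "\<And>x. isCont f x" and "lsc g"
  shows "closed {x. composite f g x \<le> ereal c}"
proof -
  have "open {x. ereal c < composite f g x}"
  proof (subst open_subopen, intro ballI)
    fix x assume "x \<in> {x. ereal c < composite f g x}"
    then have "ereal (c - f x) < g x"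
      unfolding composite_def by (cases "g x") auto
    then obtain e where e: "ereal (c - f x) < ereal e" "ereal e < g x"
      using ereal_dense2 by blast
    have "eventually (\<lambda>y. ereal e < g y) (at x)"
      using \<open>lsc g\<close> e(2) unfolding lsc_def le_Liminf_iff by blast
    moreover have "eventually (\<lambda>y. c - e < f y) (at x)"
      using cont[of x] e(1) unfolding isCont_def by (intro order_tendstoD) auto
    ultimately have "eventually (\<lambda>y. ereal c < composite f g y) (at x)"
    proof eventually_elim
      case (elim y)
      then show ?case unfolding composite_def by (cases "g y") auto
    qed
    then obtain T where "open T" "x \<in> T" "\<forall>y\<in>T. y \<noteq> x \<longrightarrow> ereal c < composite f g y"
      unfolding eventually_at_topological by blast
    then show "\<exists>T. open T \<and> x \<in> T \<and> T \<subseteq> {x. ereal c < composite f g x}"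
      using \<open>x \<in> {x. ereal c < composite f g x}\<close> by (intro exI[of _ T]) auto
  qed
  then show ?thesis
    unfolding closed_def by (simp add: Compl_eq not_le)
qed

lemma nonneg_of_perturbation:
  fixes a b :: real
  assumes "\<And>t. 0 < t \<Longrightarrow> t \<le> 1 \<Longrightarrow> 0 \<le> a + t * b"
  shows "0 \<le> a"
proof (rule ccontr)
  assume "\<not> 0 \<le> a"
  \<comment> \<open>this choice makes \<open>t * b\<close> at most \<open>- a / 2\<close>\<close>
  define t where "t = min 1 (- a / (2 * (\<bar>b\<bar> + 1)))"
  have t: "0 < t" "t \<le> 1"
    using \<open>\<not> 0 \<le> a\<close> divide_pos_pos[of "- a" "2 * (\<bar>b\<bar> + 1)"] by (auto simp: t_def)
  have "t * b \<le> t * (\<bar>b\<bar> + 1)"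
    using t by (intro mult_left_mono) auto
  also have "\<dots> \<le> (- a / (2 * (\<bar>b\<bar> + 1))) * (\<bar>b\<bar> + 1)"
    by (intro mult_right_mono) (auto simp: t_def)
  also have "\<dots> = - a / 2"
    by (simp add: field_simps add_nonneg_eq_0_iff)
  finally show False
    using assms[OF t] \<open>\<not> 0 \<le> a\<close> by linarith
qed

text \<open>
  Fermat's rule for the proximal map, obtained by comparing \<open>x\<close> with the points \<open>(1 - t) x + t y\<close>: the quadratic term
  contributes its linear part of order \<open>t\<close> and an error of order \<open>t\<^sup>2\<close> that disappears after division by \<open>t\<close>.
\<close>

lemma prox_subgradient:
  fixes h :: "'a::real_inner \<Rightarrow> ereal"
  assumes "x \<in> prox h u" and fin: "\<And>w. w \<in> D \<Longrightarrow> h w = ereal (r w)"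
    and r: "convex_on D r" and xy: "x \<in> D" "y \<in> D"
  shows "r x + (u - x) \<bullet> (y - x) \<le> r y"
proof -
  have "0 \<le> (r y - r x - (u - x) \<bullet> (y - x)) + t * (1/2 * (norm (y - x))\<^sup>2)"
    if t: "0 < t" "t \<le> 1" for t
  proof -
    define w where "w = (1 - t) *\<^sub>R x + t *\<^sub>R y"
    have w: "w = x + t *\<^sub>R (y - x)" by (simp add: w_def algebra_simps)
    have "w \<in> D"
      unfolding w_def using convexD_alt[OF convex_on_imp_convex[OF r] xy] t by simp
    have "r w \<le> (1 - t) * r x + t * r y"
      unfolding w_def by (rule convex_onD[OF r]) (use t xy in auto)
    moreover have "h x + ereal (1/2 * (norm (x - u))\<^sup>2) \<le> h w + ereal (1/2 * (norm (w - u))\<^sup>2)"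
      using assms(1) unfolding prox_def argmin_def is_arg_min_def by (auto simp: not_less)
    then have "r x + 1/2 * (norm (x - u))\<^sup>2 \<le> r w + 1/2 * (norm (w - u))\<^sup>2"
      using fin \<open>w \<in> D\<close> xy by simp
    moreover have "(norm (w - u))\<^sup>2
        = (norm (x - u))\<^sup>2 - 2 * t * ((u - x) \<bullet> (y - x)) + t\<^sup>2 * (norm (y - x))\<^sup>2"
    proof -
      have "(norm (e + t *\<^sub>R d))\<^sup>2 = (norm e)\<^sup>2 - 2 * t * ((- e) \<bullet> d) + t\<^sup>2 * (norm d)\<^sup>2" for e d :: 'a
        unfolding power2_norm_eq_inner
        by (simp add: inner_add_left inner_add_right inner_commute power2_eq_square algebra_simps)
      from this[of "x - u" "y - x"] show ?thesis by (simp add: w diff_add_eq)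
    qed
    ultimately have "0 \<le> t * ((r y - r x - (u - x) \<bullet> (y - x)) + t * (1/2 * (norm (y - x))\<^sup>2))"
      by (simp add: algebra_simps power2_eq_square)
    then show ?thesis using t by (simp add: zero_le_mult_iff)
  qed
  then have "0 \<le> r y - r x - (u - x) \<bullet> (y - x)"
    by (rule nonneg_of_perturbation)
  then show ?thesis by simp
qed

section \<open>Solutions and sublevel sets of the bilevel problem\<close>

locale bilevel_problem =
  fixes f1 f2 :: "'a::euclidean_space \<Rightarrow> real" and g1 g2 :: "'a \<Rightarrow> ereal"
  assumes basic: "basic_assumption f1 g1 f2 g2"
begin

lemma f_convex: "convex_on UNIV f1" "convex_on UNIV f2"
  and f_diff: "\<And>x. f1 differentiable (at x)" "\<And>x. f2 differentiable (at x)"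
  and f_lip: "locally_lipschitz (grad f1)" "locally_lipschitz (grad f2)"
  and g_proper: "proper g1" "proper g2"
  and g_lsc: "lsc g1" "lsc g2"
  and g_convex: "ext_convex g1" "ext_convex g2"
  using basic unfolding basic_assumption_def by auto

lemmas GDERIV_f = GDERIV_grad[OF f_diff(1)] GDERIV_grad[OF f_diff(2)]
lemmas tangent1 = convex_above_tangent[OF f_convex(1) GDERIV_f(1)]
lemmas tangent2 = convex_above_tangent[OF f_convex(2) GDERIV_f(2)]

abbreviation "X \<equiv> solutions f1 g1 f2 g2"

text \<open>
  All iterates with nonnegative index and all solutions have finite objective values, hence lie in
  \<open>common_dom\<close>; on this convex set the extended-valued data is replaced by real-valued functions.  The constants
  \<open>opt\<close>, \<open>inf1\<close> and \<open>inf2\<close> are the bilevel optimal value, the infimum of the upper objective over the domain of the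
  lower one, and the minimum of the lower objective.
\<close>

definition common_dom :: "'a set" where "common_dom = dom g1 \<inter> dom g2"
definition g1_real :: "'a \<Rightarrow> real" where "g1_real w = real_of_ereal (g1 w)"
definition g2_real :: "'a \<Rightarrow> real" where "g2_real w = real_of_ereal (g2 w)"
definition phi1 :: "'a \<Rightarrow> real" where "phi1 w = f1 w + g1_real w"
definition phi2 :: "'a \<Rightarrow> real" where "phi2 w = f2 w + g2_real w"
definition opt :: real where "opt = real_of_ereal (opt_value f1 g1 f2 g2)"
definition inf1 :: real where "inf1 = real_of_ereal (inf_upper f1 g1 f2 g2)"
definition inf2 :: real where "inf2 = real_of_ereal (inf_lower f2 g2)"

lemma g_eq: "w \<in> common_dom \<Longrightarrow> g1 w = ereal (g1_real w)" "w \<in> common_dom \<Longrightarrow> g2 w = ereal (g2_real w)"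
  using proper_finite[OF g_proper(1)] proper_finite[OF g_proper(2)]
  by (auto simp: common_dom_def g1_real_def g2_real_def)

lemma composite_eq:
  "w \<in> common_dom \<Longrightarrow> composite f1 g1 w = ereal (phi1 w)"
  "w \<in> common_dom \<Longrightarrow> composite f2 g2 w = ereal (phi2 w)"
  by (simp_all add: composite_def g_eq phi1_def phi2_def)

lemma dom_composite [simp]: "dom (composite f1 g1) = dom g1" "dom (composite f2 g2) = dom g2"
  by (auto simp: dom_def composite_def)

lemma common_dom_iff: "w \<in> common_dom \<longleftrightarrow> composite f1 g1 w < \<infinity> \<and> composite f2 g2 w < \<infinity>"
  by (auto simp: common_dom_def dom_def composite_def)

lemma convex_common_dom: "convex common_dom"
  unfolding common_dom_def by (intro convex_Int convex_dom g_convex)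

lemma g_real_convex: "convex_on common_dom g1_real" "convex_on common_dom g2_real"
  using convex_on_real_of_ereal[OF g_proper(1) g_convex(1)]
    convex_on_real_of_ereal[OF g_proper(2) g_convex(2)] convex_common_dom
  unfolding g1_real_def[abs_def] g2_real_def[abs_def]
  by (auto intro: convex_on_subset simp: common_dom_def)

lemma phi_convex: "convex_on common_dom phi1" "convex_on common_dom phi2"
  unfolding phi1_def[abs_def] phi2_def[abs_def]
  by (intro convex_on_add g_real_convex convex_on_subset[OF f_convex(1)]
      convex_on_subset[OF f_convex(2)] convex_common_dom subset_UNIV)+

lemma X_nonempty: "X \<noteq> {}" and X_bounded: "bounded X"
  using basic unfolding basic_assumption_def by auto

lemma solutionsD:
  assumes "z \<in> X"
  shows "z \<in> common_dom" "opt_value f1 g1 f2 g2 = ereal (phi1 z)" "inf_lower f2 g2 = ereal (phi2 z)"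
    "lower_solutions f2 g2 = {w. composite f2 g2 w \<le> composite f2 g2 z}"
proof -
  have z: "z \<in> lower_solutions f2 g2"
    and min1: "\<And>w. w \<in> lower_solutions f2 g2 \<Longrightarrow> composite f1 g1 z \<le> composite f1 g1 w"
    using assms unfolding solutions_def argmin_def is_arg_min_def by (auto simp: not_less)
  have min2: "composite f2 g2 z \<le> composite f2 g2 w" for w
    using z unfolding lower_solutions_def argmin_def is_arg_min_def by (auto simp: not_less)
  have o: "opt_value f1 g1 f2 g2 = composite f1 g1 z"
    unfolding opt_value_def using z min1 by (auto intro!: antisym INF_lower INF_greatest)
  have l: "inf_lower f2 g2 = composite f2 g2 z"
    unfolding inf_lower_def using min2 by (auto intro!: antisym INF_lower INF_greatest)
  obtain w where "g2 w < \<infinity>"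
    using g_proper(2) unfolding proper_def dom_def by blast
  then have "composite f2 g2 w < \<infinity>" by (simp add: composite_def)
  then have "composite f2 g2 z < \<infinity>" using min2[of w] by (rule le_less_trans[rotated])
  moreover have "composite f1 g1 z < \<infinity>"
    using basic o unfolding basic_assumption_def by auto
  ultimately show "z \<in> common_dom" by (simp add: common_dom_iff)
  with o l show "opt_value f1 g1 f2 g2 = ereal (phi1 z)" "inf_lower f2 g2 = ereal (phi2 z)"
    by (simp_all add: composite_eq)
  show "lower_solutions f2 g2 = {w. composite f2 g2 w \<le> composite f2 g2 z}"
    using min2 unfolding lower_solutions_def argmin_def is_arg_min_def
    by (auto simp: not_less intro: order_trans)
qed

lemma phi_solution: "z \<in> X \<Longrightarrow> phi1 z = opt" "z \<in> X \<Longrightarrow> phi2 z = inf2"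
  using solutionsD by (simp_all add: opt_def inf2_def)

lemma opt_value_eq: "opt_value f1 g1 f2 g2 = ereal opt"
  and inf_lower_eq: "inf_lower f2 g2 = ereal inf2"
  using X_nonempty solutionsD phi_solution by auto

lemma inf_upper_eq: "inf_upper f1 g1 f2 g2 = ereal inf1"
proof -
  obtain z where "z \<in> X" using X_nonempty by blast
  then have z: "z \<in> common_dom" by (rule solutionsD)
  then have "inf_upper f1 g1 f2 g2 \<le> ereal (phi1 z)"
    unfolding inf_upper_def by (intro INF_lower2[of z]) (auto simp: composite_eq common_dom_def)
  moreover have "inf_upper f1 g1 f2 g2 > -\<infinity>"
    using basic unfolding basic_assumption_def by auto
  ultimately show ?thesis
    unfolding inf1_def by (cases "inf_upper f1 g1 f2 g2") auto
qed

lemma inf1_le: "w \<in> common_dom \<Longrightarrow> inf1 \<le> phi1 w"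
  and inf2_le: "w \<in> common_dom \<Longrightarrow> inf2 \<le> phi2 w"
proof -
  assume w: "w \<in> common_dom"
  then have "inf_upper f1 g1 f2 g2 \<le> composite f1 g1 w"
    unfolding inf_upper_def by (intro INF_lower) (auto simp: common_dom_def)
  with w show "inf1 \<le> phi1 w" by (simp add: inf_upper_eq composite_eq)
  have "inf_lower f2 g2 \<le> composite f2 g2 w"
    unfolding inf_lower_def by (intro INF_lower) auto
  with w show "inf2 \<le> phi2 w" by (simp add: inf_lower_eq composite_eq)
qed

lemma inf1_le_opt: "inf1 \<le> opt"
  using X_nonempty inf1_le solutionsD(1) phi_solution(1) by (metis all_not_in_conv)

lemma solutionsI:
  assumes "w \<in> common_dom" "phi1 w \<le> opt" "phi2 w \<le> inf2"
  shows "w \<in> X"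
proof -
  obtain z where z: "z \<in> X" using X_nonempty by blast
  have "composite f2 g2 z = ereal inf2"
    using composite_eq(2)[OF solutionsD(1)[OF z]] phi_solution(2)[OF z] by simp
  then have "w \<in> lower_solutions f2 g2"
    using solutionsD(4)[OF z] assms by (simp add: composite_eq)
  moreover have "composite f1 g1 w \<le> composite f1 g1 y" if "y \<in> lower_solutions f2 g2" for y
  proof -
    have "composite f1 g1 w \<le> opt_value f1 g1 f2 g2"
      using assms by (simp add: opt_value_eq composite_eq)
    also have "\<dots> \<le> composite f1 g1 y"
      unfolding opt_value_def using that by (rule INF_lower)
    finally show ?thesis .
  qed
  ultimately show ?thesis
    unfolding solutions_def argmin_def is_arg_min_def by (auto simp: not_less)
qed

text \<open>
  The points that are optimal up to \<open>c\<close> for both levels.  They form closed convex sets that shrink to the solution set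
  as \<open>c\<close> tends to 0; this is how boundedness of the solution set enters.
\<close>

definition sublevel :: "real \<Rightarrow> 'a set" where
  "sublevel c = {w. composite f1 g1 w \<le> ereal (opt + c) \<and> composite f2 g2 w \<le> ereal (inf2 + c)}"

lemma mem_sublevel: "w \<in> sublevel c \<longleftrightarrow> w \<in> common_dom \<and> phi1 w \<le> opt + c \<and> phi2 w \<le> inf2 + c"
proof -
  have "w \<in> common_dom" if "w \<in> sublevel c"
    using that unfolding sublevel_def common_dom_iff by (auto intro: le_less_trans)
  moreover have "w \<in> sublevel c \<longleftrightarrow> phi1 w \<le> opt + c \<and> phi2 w \<le> inf2 + c" if "w \<in> common_dom"
    using that by (simp add: sublevel_def composite_eq)
  ultimately show ?thesis by blast
qed

lemma closed_sublevel: "closed (sublevel c)"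
  unfolding sublevel_def
  using closed_Int[OF closed_sublevel_composite[OF GDERIV_isCont[OF GDERIV_f(1)] g_lsc(1)]
      closed_sublevel_composite[OF GDERIV_isCont[OF GDERIV_f(2)] g_lsc(2)]]
  by (simp add: Collect_conj_eq)

lemma sublevel_0: "sublevel 0 = X"
proof (rule set_eqI)
  fix w
  show "w \<in> sublevel 0 \<longleftrightarrow> w \<in> X"
    using solutionsI[of w] solutionsD(1)[of w] phi_solution[of w] unfolding mem_sublevel
    by (metis add_0_right order_refl)
qed

lemma closed_X: "closed X"
  using closed_sublevel[of 0] by (simp add: sublevel_0)

text \<open>
  Within a ball this is compactness: a common point of all sets of counterexamples would be a solution at positive
  distance from the solution set.
\<close>

lemma sublevel_near_solutions:
  assumes "\<epsilon> > 0"
  obtains \<delta> where "\<delta> > 0" "\<And>w. w \<in> sublevel \<delta> \<Longrightarrow> norm w \<le> B \<Longrightarrow> infdist w X < \<epsilon>"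
proof -
  \<comment> \<open>if no \<open>1 / (n + 1)\<close> served as \<open>\<delta>\<close>, the sets of counterexamples would be a nested family of nonempty compact sets\<close>
  define S where "S = (\<lambda>n::nat. cball 0 B \<inter> sublevel (1 / Suc n) \<inter> {w. \<epsilon> \<le> infdist w X})"
  have "\<exists>n. S n = {}"
  proof (rule ccontr)
    assume "\<not> (\<exists>n. S n = {})"
    then have "\<Inter>(range S) \<noteq> {}"
    proof (intro compact_nest)
      fix n
      have "closed {w. \<epsilon> \<le> infdist w X}"
        by (intro closed_Collect_le continuous_intros)
      then show "compact (S n)"
        unfolding S_def by (intro compact_Int_closed compact_cball closed_sublevel)
    next
      fix m n :: nat assume "m \<le> n"
      then have "1 / real (Suc n) \<le> 1 / real (Suc m)" by (simp add: field_simps)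
      then show "S n \<subseteq> S m"
        unfolding S_def by (auto simp: mem_sublevel simp del: of_nat_Suc)
    qed auto
    then obtain w where w: "\<And>n. w \<in> S n" by auto
    have "phi1 w \<le> opt + e \<and> phi2 w \<le> inf2 + e" if "e > 0" for e
    proof -
      obtain n where "1 / real (Suc n) < e"
        using nat_approx_posE[OF \<open>e > 0\<close>] by blast
      moreover have "w \<in> sublevel (1 / Suc n)" using w[of n] unfolding S_def by blast
      ultimately show ?thesis unfolding mem_sublevel by linarith
    qed
    moreover have "w \<in> common_dom" using w[of 0] by (simp add: S_def mem_sublevel)
    ultimately have "w \<in> X"
      by (intro solutionsI) (auto intro: field_le_epsilon)
    then have "infdist w X = 0" by simp
    with w[of 0] assms show False by (simp add: S_def)
  qed
  then obtain n where "S n = {}" by blast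
  have "infdist w X < \<epsilon>" if "w \<in> sublevel (1 / Suc n)" "norm w \<le> B" for w
  proof (rule ccontr)
    assume "\<not> infdist w X < \<epsilon>"
    with that have "w \<in> S n" by (simp add: S_def)
    with \<open>S n = {}\<close> show False by simp
  qed
  then show thesis by (intro that[of "1 / Suc n"]) auto
qed

text \<open>
  A far point \<open>w\<close> of the sublevel set and a solution \<open>z\<close> span a segment on which, by convexity, the excess over the
  optimal values is proportional to the distance from \<open>z\<close>.  At a fixed distance \<open>r\<close> from \<open>z\<close> the excess is then
  so small that the point must be near the solution set, although \<open>r\<close> exceeds all distances from \<open>z\<close> to solutions
  by 1.
\<close>

lemma bounded_sublevel: "bounded (sublevel c)"
proof -
  obtain z where z: "z \<in> X" using X_nonempty by blast
  obtain r0 where r0: "\<And>y. y \<in> X \<Longrightarrow> dist z y \<le> r0"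
    using X_bounded bounded_any_center[of X z] by blast
  define r where "r = r0 + 1"
  have "r0 \<ge> 0" using r0[OF z] by simp
  then have "r > 0" by (simp add: r_def)
  obtain \<delta> where \<delta>: "\<delta> > 0"
    "\<And>w. w \<in> sublevel \<delta> \<Longrightarrow> norm w \<le> norm z + r \<Longrightarrow> infdist w X < 1"
    using sublevel_near_solutions[of 1 "norm z + r"] by auto
  \<comment> \<open>beyond this distance the ratio \<open>t = r / dist z w\<close> satisfies \<open>t < 1\<close> and \<open>t * c \<le> \<delta>\<close>\<close>
  have "dist z w \<le> r + r * \<bar>c\<bar> / \<delta>" if w: "w \<in> sublevel c" for w
  proof (rule ccontr)
    assume far: "\<not> dist z w \<le> r + r * \<bar>c\<bar> / \<delta>"
    define D where "D = dist z w"
    have "0 \<le> r * \<bar>c\<bar> / \<delta>" using \<open>\<delta> > 0\<close> \<open>r > 0\<close> by simp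
    with far \<open>r > 0\<close> have D: "D > r" "D > r * \<bar>c\<bar> / \<delta>"
      unfolding D_def by linarith+
    define t where "t = r / D"
    have t: "0 < t" "t < 1" using D(1) \<open>r > 0\<close> by (auto simp: t_def)
    have tc: "t * c \<le> \<delta>"
    proof -
      have "t * c \<le> t * \<bar>c\<bar>" using t by (intro mult_left_mono) auto
      also have "\<dots> \<le> \<delta>" using D \<open>r > 0\<close> \<open>\<delta> > 0\<close> by (simp add: t_def field_simps)
      finally show ?thesis .
    qed
    define y where "y = (1 - t) *\<^sub>R z + t *\<^sub>R w"
    have y: "y = z + t *\<^sub>R (w - z)" by (simp add: y_def algebra_simps)
    have zC: "z \<in> common_dom" and wC: "w \<in> common_dom" using z w solutionsD(1) by (auto simp: mem_sublevel)
    have "phi1 y \<le> (1 - t) * phi1 z + t * phi1 w" "phi2 y \<le> (1 - t) * phi2 z + t * phi2 w"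
      unfolding y_def using t zC wC by (intro convex_onD[OF phi_convex(1)] convex_onD[OF phi_convex(2)]; simp)+
    moreover have "t * phi1 w \<le> t * (opt + c)" "t * phi2 w \<le> t * (inf2 + c)"
      using w t by (auto simp: mem_sublevel)
    ultimately have "phi1 y \<le> opt + t * c" "phi2 y \<le> inf2 + t * c"
      using phi_solution[OF z] by (auto simp: algebra_simps)
    moreover have "y \<in> common_dom"
      unfolding y_def using convexD_alt[OF convex_common_dom zC wC] t by simp
    ultimately have "y \<in> sublevel \<delta>" using tc by (simp add: mem_sublevel)
    have dist_y: "dist z y = r"
    proof -
      have "norm (w - z) = D" by (simp add: D_def dist_norm norm_minus_commute)
      then show ?thesis using D \<open>r > 0\<close> by (simp add: y dist_norm t_def)
    qed
    then have "norm y \<le> norm z + r"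
      using norm_triangle_sub[of y z] by (simp add: dist_norm norm_minus_commute)
    with \<delta>(2)[OF \<open>y \<in> sublevel \<delta>\<close>] have "infdist y X < 1" by blast
    moreover obtain q where "q \<in> X" "infdist y X = dist y q"
      using infdist_attains_inf[OF closed_X X_nonempty] by blast
    ultimately have "dist z y < r0 + 1"
      using r0[of q] dist_triangle2[of z y q] by linarith
    then show False using dist_y by (simp add: r_def)
  qed
  then show ?thesis
    using bounded_any_center[of "sublevel c" z] by blast
qed

end

section \<open>The proximal gradient iteration\<close>

lemma grad_f_pen:
  fixes f1 f2 :: "'a::euclidean_space \<Rightarrow> real"
  assumes "f1 differentiable (at y)" "f2 differentiable (at y)"
  shows "grad (f_pen f1 f2 s) y = s *\<^sub>R grad f1 y + grad f2 y"
  by (intro grad_eqI GDERIV_f_pen GDERIV_grad assms)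

locale bilevel_iterates = bilevel_problem f1 f2 g1 g2
  for f1 f2 :: "'a::euclidean_space \<Rightarrow> real" and g1 g2 :: "'a \<Rightarrow> ereal" +
  fixes \<sigma> \<alpha> :: "int \<Rightarrow> real" and x :: "int \<Rightarrow> 'a" and \<alpha>min \<alpha>max \<nu> :: real
  assumes sigma_pos: "\<forall>k\<ge>-1. \<sigma> k > 0"
    and alpha_pos: "\<forall>k\<ge>-1. \<alpha> k > 0"
    and sigma_init: "\<sigma> 0 \<le> \<sigma> (-1)"
    and iterates: "prox_grad_iterates f1 g1 f2 g2 \<sigma> \<alpha> x"
    and params: "\<alpha>max \<ge> \<alpha>min" "\<alpha>min > 0" "0 < \<nu>" "\<nu> < 1"
    and well_defined: "\<forall>k\<ge>0. hat_numerator_arg f2 \<sigma> \<alpha> x k \<ge> 0"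
    and step_upper: "\<forall>k\<ge>0. ereal (\<alpha> (k + 1)) \<le> min (alpha_hat_next f1 f2 \<sigma> \<alpha> x k) (ereal \<alpha>max)"
    and step_curv: "\<forall>k\<ge>0. \<alpha> (k + 1) * ell f1 f2 \<sigma> x (k + 1) \<le> \<nu>"
    and step_lower: "\<forall>k\<ge>0. \<alpha> (k + 1) \<ge> \<alpha>min"
    and sigma_decr: "\<forall>k\<ge>0. 0 < \<sigma> (k + 1) \<and> \<sigma> (k + 1) \<le> \<sigma> k"
    and sigma_lim: "(\<lambda>k::nat. \<sigma> (int k)) \<longlonglongrightarrow> 0"
    and sigma_sum: "filterlim (\<lambda>K::nat. \<Sum>k\<le>K. \<sigma> (int k)) at_top sequentially"
begin

lemma sigma_gt_0: "k \<ge> -1 \<Longrightarrow> 0 < \<sigma> k" and alpha_gt_0: "k \<ge> -1 \<Longrightarrow> 0 < \<alpha> k"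
  using sigma_pos alpha_pos by auto

lemma sigma_mono: "k \<ge> 0 \<Longrightarrow> \<sigma> k \<le> \<sigma> (k - 1)"
  using sigma_init sigma_decr[rule_format, of "k - 1"] by (cases "k = 0") auto

lemma sigma_le_sigma0: "\<sigma> (int n) \<le> \<sigma> 0"
proof (induction n)
  case (Suc n)
  have "\<sigma> (int (Suc n)) \<le> \<sigma> (int n)" using sigma_mono[of "int (Suc n)"] by simp
  with Suc show ?case by linarith
qed simp

lemma alpha_bounds: "k \<ge> 1 \<Longrightarrow> \<alpha> k \<le> \<alpha>max" "k \<ge> 1 \<Longrightarrow> \<alpha>min \<le> \<alpha> k"
  using step_upper[rule_format, of "k - 1"] step_lower[rule_format, of "k - 1"] by auto

text \<open>
  \<open>residual k\<close> is the subgradient of the penalized objective at \<open>x k\<close> that the optimality condition of the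
  prox step provides, and \<open>merit k\<close> is the value at \<open>x k\<close> of the penalized objective, with both objectives shifted by
  their infima.  The \<open>upper_gap\<close> may be negative: an iterate that is not optimal for the lower problem can beat the
  bilevel optimal value.
\<close>

definition grad_pen :: "int \<Rightarrow> 'a \<Rightarrow> 'a" where "grad_pen k y = \<sigma> k *\<^sub>R grad f1 y + grad f2 y"
definition residual :: "int \<Rightarrow> 'a" where
  "residual k = (1 / \<alpha> k) *\<^sub>R (x (k - 1) - x k) - (grad_pen k (x (k - 1)) - grad_pen k (x k))"
definition upper_gap :: "int \<Rightarrow> real" where "upper_gap k = phi1 (x k) - opt"
definition lower_gap :: "int \<Rightarrow> real" where "lower_gap k = phi2 (x k) - inf2"
definition merit :: "int \<Rightarrow> real" where "merit k = \<sigma> k * (phi1 (x k) - inf1) + lower_gap k"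
definition step :: "int \<Rightarrow> real" where "step k = norm (x (k - 1) - x k)"
abbreviation "rh k \<equiv> rho \<sigma> \<alpha> k"

lemma grad_f_pen_sigma: "grad (f_pen f1 f2 (\<sigma> k)) y = grad_pen k y"
  unfolding grad_pen_def by (rule grad_f_pen[OF f_diff])

lemma iterate_in_common_dom: assumes "k \<ge> 0" shows "x k \<in> common_dom"
proof -
  obtain z where "z \<in> X" using X_nonempty by blast
  then have z: "z \<in> common_dom" by (rule solutionsD)
  define h where "h = (\<lambda>w. ereal (\<alpha> k) * g_pen g1 g2 (\<sigma> k) w)"
  have "x k \<in> prox h (x (k - 1) - \<alpha> k *\<^sub>R grad (f_pen f1 f2 (\<sigma> k)) (x (k - 1)))"
    using iterates assms unfolding prox_grad_iterates_def h_def by blast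
  then obtain e e' :: real where "h (x k) + ereal e \<le> h z + ereal e'"
    unfolding prox_def argmin_def is_arg_min_def by (auto simp: not_less)
  moreover have "h z < \<infinity>" using z by (simp add: h_def g_pen_def g_eq)
  ultimately have "h (x k) < \<infinity>" by (cases "h (x k)"; cases "h z") auto
  moreover have "g1 (x k) \<noteq> -\<infinity>" "g2 (x k) \<noteq> -\<infinity>"
    using g_proper unfolding proper_def by auto
  ultimately show ?thesis
    using sigma_gt_0[of k] alpha_gt_0[of k] assms unfolding h_def g_pen_def common_dom_def dom_def
    by (cases "g1 (x k)"; cases "g2 (x k)") auto
qed

text \<open>
  Only the nonsmooth part is linearized here, with the gradient of the smooth part still taken at the previous
  iterate; the estimate for two consecutive steps needs this form.
\<close>

lemma prox_step_inequality:
  assumes "k \<ge> 0" "y \<in> common_dom"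
  shows "\<sigma> k * g1_real (x k) + g2_real (x k)
      + ((1 / \<alpha> k) *\<^sub>R (x (k - 1) - x k) - grad_pen k (x (k - 1))) \<bullet> (y - x k) \<le> \<sigma> k * g1_real y + g2_real y"
proof -
  have s: "\<sigma> k > 0" and a: "\<alpha> k > 0" using sigma_gt_0 alpha_gt_0 assms by auto
  define r where "r = (\<lambda>w. \<alpha> k * (\<sigma> k * g1_real w + g2_real w))"
  have "convex_on common_dom r"
    unfolding r_def using s a
    by (intro convex_on_cmul convex_on_add g_real_convex) auto
  moreover have "ereal (\<alpha> k) * g_pen g1 g2 (\<sigma> k) w = ereal (r w)" if "w \<in> common_dom" for w
    using that by (simp add: g_pen_def g_eq r_def)
  moreover have "x k \<in> prox (\<lambda>w. ereal (\<alpha> k) * g_pen g1 g2 (\<sigma> k) w) (x (k - 1) - \<alpha> k *\<^sub>R grad_pen k (x (k - 1)))"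
    using iterates assms unfolding prox_grad_iterates_def grad_f_pen_sigma by blast
  ultimately have "r (x k) + (x (k - 1) - \<alpha> k *\<^sub>R grad_pen k (x (k - 1)) - x k) \<bullet> (y - x k) \<le> r y"
    using prox_subgradient iterate_in_common_dom assms by blast
  moreover have "x (k - 1) - \<alpha> k *\<^sub>R grad_pen k (x (k - 1)) - x k
      = \<alpha> k *\<^sub>R ((1 / \<alpha> k) *\<^sub>R (x (k - 1) - x k) - grad_pen k (x (k - 1)))"
    using a by (simp add: algebra_simps)
  ultimately have "\<alpha> k * (\<sigma> k * g1_real (x k) + g2_real (x k)
      + ((1 / \<alpha> k) *\<^sub>R (x (k - 1) - x k) - grad_pen k (x (k - 1))) \<bullet> (y - x k)) \<le> \<alpha> k * (\<sigma> k * g1_real y + g2_real y)"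
    unfolding r_def by (simp add: distrib_left)
  then show ?thesis using a by simp
qed

lemma tangent_pen:
  assumes "k \<ge> 0"
  shows "\<sigma> k * f1 u + f2 u + grad_pen k u \<bullet> (y - u) \<le> \<sigma> k * f1 y + f2 y"
  using mult_left_mono[OF tangent1, of "\<sigma> k" u y] tangent2[of u y] sigma_gt_0[of k] assms
  by (simp add: grad_pen_def inner_add_left algebra_simps)

lemma residual_subgradient:
  assumes "k \<ge> 0" "y \<in> common_dom"
  shows "\<sigma> k * phi1 (x k) + phi2 (x k) + residual k \<bullet> (y - x k) \<le> \<sigma> k * phi1 y + phi2 y"
  using prox_step_inequality[OF assms] tangent_pen[OF assms(1), of "x k" y]
  by (simp add: residual_def phi1_def phi2_def inner_diff_left inner_add_left algebra_simps)

lemma ell_step: "ell f1 f2 \<sigma> x k * (step k)\<^sup>2 = (grad_pen k (x (k - 1)) - grad_pen k (x k)) \<bullet> (x (k - 1) - x k)"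
  unfolding ell_def step_def curv_mult_norm grad_f_pen_sigma ..

lemma Lk_step: "(Lk f1 f2 \<sigma> x k)\<^sup>2 * (step k)\<^sup>2 = (norm (grad_pen k (x (k - 1)) - grad_pen k (x k)))\<^sup>2"
  unfolding Lk_def step_def lip_est_mult_norm grad_f_pen_sigma ..

lemma ell2_step: "ell2 f2 x k * (step k)\<^sup>2 = (grad f2 (x (k - 1)) - grad f2 (x k)) \<bullet> (x (k - 1) - x k)"
  unfolding ell2_def step_def curv_mult_norm ..

lemma ell2_nonneg: "0 \<le> ell2 f2 x k"
  unfolding ell2_def by (rule curv_nonneg[OF f_convex(2) f_diff(2)])

lemma step_sq: "(step k)\<^sup>2 = (x (k - 1) - x k) \<bullet> (x (k - 1) - x k)"
  by (simp add: step_def power2_norm_eq_inner)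

lemma residual_inner_step:
  assumes "k \<ge> 0"
  shows "\<alpha> k * (residual k \<bullet> (x (k - 1) - x k)) = (1 - \<alpha> k * ell f1 f2 \<sigma> x k) * (step k)\<^sup>2"
proof -
  have "\<alpha> k \<noteq> 0" using alpha_gt_0[of k] assms by simp
  then have "\<alpha> k * (residual k \<bullet> (x (k - 1) - x k))
    = (step k)\<^sup>2 - \<alpha> k * ((grad_pen k (x (k - 1)) - grad_pen k (x k)) \<bullet> (x (k - 1) - x k))"
    unfolding residual_def step_sq by (simp add: inner_diff_left[of "_ *\<^sub>R _"] right_diff_distrib)
  then show ?thesis
    unfolding ell_step[symmetric] by (simp add: algebra_simps)
qed

text \<open>
  Splitting off the expression of \<open>residual_inner_step\<close>, which convexity turns into a difference of objective values,
  leaves exactly the quantity under the square root in the denominator of the stepsize bound.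
\<close>

lemma residual_norm_sq:
  assumes "k \<ge> 0"
  shows "(norm (\<alpha> k *\<^sub>R residual k))\<^sup>2
    = (1 - \<alpha> k * ell f1 f2 \<sigma> x k) * (step k)\<^sup>2 + hat_denominator_arg f1 f2 \<sigma> \<alpha> x k * (step k)\<^sup>2"
proof -
  define d where "d = x (k - 1) - x k"
  define g where "g = grad_pen k (x (k - 1)) - grad_pen k (x k)"
  have "\<alpha> k \<noteq> 0" using alpha_gt_0[of k] assms by simp
  then have eq: "\<alpha> k *\<^sub>R residual k = d - \<alpha> k *\<^sub>R g"
    unfolding residual_def by (simp add: d_def g_def scaleR_right_diff_distrib)
  have "(norm (\<alpha> k *\<^sub>R residual k))\<^sup>2 = d \<bullet> d - 2 * \<alpha> k * (g \<bullet> d) + (\<alpha> k)\<^sup>2 * (norm g)\<^sup>2"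
    unfolding eq power2_norm_eq_inner
    by (simp add: inner_diff_left inner_diff_right inner_commute power2_eq_square algebra_simps)
  also have "d \<bullet> d = (step k)\<^sup>2" unfolding d_def by (rule step_sq[symmetric])
  also have "g \<bullet> d = ell f1 f2 \<sigma> x k * (step k)\<^sup>2" unfolding d_def g_def by (rule ell_step[symmetric])
  also have "(norm g)\<^sup>2 = (Lk f1 f2 \<sigma> x k)\<^sup>2 * (step k)\<^sup>2" unfolding g_def by (rule Lk_step[symmetric])
  finally show ?thesis unfolding hat_denominator_arg_def by (simp add: algebra_simps)
qed

lemma lower_gap_nonneg: "k \<ge> 0 \<Longrightarrow> 0 \<le> lower_gap k"
  unfolding lower_gap_def using inf2_le iterate_in_common_dom by simp

lemma lower_gap_le_merit: "k \<ge> 0 \<Longrightarrow> lower_gap k \<le> merit k"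
  unfolding merit_def using inf1_le[OF iterate_in_common_dom] sigma_gt_0[of k] by simp

lemma merit_nonneg: "k \<ge> 0 \<Longrightarrow> 0 \<le> merit k"
  using lower_gap_nonneg lower_gap_le_merit by (meson order_trans)

text \<open>
  The subgradient inequality at \<open>x (k + 1)\<close>, tested with \<open>x k\<close>, measures the decrease of one penalized objective, and
  the curvature condition keeps it proportional to the squared step.  Passing to the smaller weight can only help,
  since the upper objective, shifted by its infimum, is nonnegative at \<open>x k\<close>.
\<close>

lemma merit_descent:
  assumes "k \<ge> 0"
  shows "(1 - \<nu>) * (step (k + 1))\<^sup>2 \<le> \<alpha> (k + 1) * (merit k - merit (k + 1))"
proof -
  have a: "\<alpha> (k + 1) > 0" using alpha_gt_0 assms by simp
  have "(1 - \<nu>) * (step (k + 1))\<^sup>2 \<le> (1 - \<alpha> (k + 1) * ell f1 f2 \<sigma> x (k + 1)) * (step (k + 1))\<^sup>2"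
    using step_curv assms by (intro mult_right_mono) auto
  also have "\<dots> = \<alpha> (k + 1) * (residual (k + 1) \<bullet> (x k - x (k + 1)))"
    using residual_inner_step[of "k + 1"] assms by simp
  also have "\<dots> \<le> \<alpha> (k + 1) * (merit k - merit (k + 1))"
  proof (rule mult_left_mono)
    have "(\<sigma> k - \<sigma> (k + 1)) * (phi1 (x k) - inf1) \<ge> 0"
      using inf1_le[OF iterate_in_common_dom[OF assms]] sigma_mono[of "k + 1"] assms by simp
    then show "residual (k + 1) \<bullet> (x k - x (k + 1)) \<le> merit k - merit (k + 1)"
      using residual_subgradient[of "k + 1" "x k"] iterate_in_common_dom[OF assms] assms
      by (simp add: merit_def lower_gap_def algebra_simps)
  qed (use a in simp)
  finally show ?thesis .
qed

lemma merit_decreasing: "k \<ge> 0 \<Longrightarrow> merit (k + 1) \<le> merit k"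
proof -
  assume k: "k \<ge> 0"
  have "0 \<le> (1 - \<nu>) * (step (k + 1))\<^sup>2" using params by simp
  also note merit_descent[OF k]
  finally show ?thesis using alpha_gt_0[of "k + 1"] k by (simp add: zero_le_mult_iff)
qed

lemma merit_le_merit0: "merit (int n) \<le> merit 0"
proof (induction n)
  case (Suc n)
  then show ?case using merit_decreasing[of "int n"] by (simp add: add.commute)
qed simp

lemma rh_pos: "k \<ge> 0 \<Longrightarrow> 0 < rh k"
  unfolding rho_def using sigma_gt_0[of k] sigma_gt_0[of "k - 1"] alpha_gt_0[of k] alpha_gt_0[of "k - 1"] by simp

text \<open>
  In terms of the ratio \<open>rho\<close> of the scaled stepsizes \<open>\<sigma> k * \<alpha> k\<close> the prefactor of the stepsize bound cancels, and
  the two entries of the minimum become the two inequalities that follow.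
\<close>

lemma rh_le:
  assumes "k \<ge> 0"
  shows "ereal (rh (k + 1)) \<le> min (ereal (sqrt (\<sigma> k / \<sigma> (k - 1) * (1 + rh k))))
         (if hat_denominator_arg f1 f2 \<sigma> \<alpha> x k \<le> 0 then \<infinity>
          else ereal (sqrt (hat_numerator_arg f2 \<sigma> \<alpha> x k) /
                      (2 * sqrt (max 0 (hat_denominator_arg f1 f2 \<sigma> \<alpha> x k)))))"
    (is "_ \<le> ?m")
proof -
  have pos: "\<sigma> k > 0" "\<sigma> (k + 1) > 0" "\<alpha> k > 0" using sigma_gt_0 alpha_gt_0 assms by auto
  define c where "c = \<sigma> k / \<sigma> (k + 1) * \<alpha> k"
  have c: "c > 0" using pos by (simp add: c_def)
  have "ereal (\<alpha> (k + 1)) \<le> ereal c * ?m"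
    using step_upper assms unfolding alpha_hat_next_def c_def by auto
  then have "ereal (1 / c) * ereal (\<alpha> (k + 1)) \<le> ereal (1 / c) * (ereal c * ?m)"
    by (rule ereal_mult_left_mono) (use c in simp)
  also have "ereal (1 / c) * (ereal c * ?m) = (ereal (1 / c) * ereal c) * ?m"
    by (simp only: mult.assoc)
  also have "ereal (1 / c) * ereal c = 1" using c by (simp add: one_ereal_def)
  also have "ereal (1 / c) * ereal (\<alpha> (k + 1)) = ereal (rh (k + 1))"
    using pos by (simp add: c_def rho_def)
  finally show ?thesis by simp
qed

lemma rh_sq_le:
  assumes "k \<ge> 0"
  shows "(rh (k + 1))\<^sup>2 \<le> \<sigma> k / \<sigma> (k - 1) * (1 + rh k)"
proof -
  have "rh (k + 1) \<le> sqrt (\<sigma> k / \<sigma> (k - 1) * (1 + rh k))"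
    using rh_le[OF assms] by simp
  moreover have "0 \<le> \<sigma> k / \<sigma> (k - 1) * (1 + rh k)"
    using sigma_gt_0[of k] sigma_gt_0[of "k - 1"] rh_pos[OF assms] assms by simp
  ultimately show ?thesis
    using power_mono[of "rh (k + 1)" "sqrt (\<sigma> k / \<sigma> (k - 1) * (1 + rh k))" 2] rh_pos[of "k + 1"] assms
    by simp
qed

lemma rh_sq_denominator_le:
  assumes "k \<ge> 0"
  shows "(rh (k + 1))\<^sup>2 * hat_denominator_arg f1 f2 \<sigma> \<alpha> x k \<le> hat_numerator_arg f2 \<sigma> \<alpha> x k / 4"
proof (cases "hat_denominator_arg f1 f2 \<sigma> \<alpha> x k \<le> 0")
  case True
  then have "(rh (k + 1))\<^sup>2 * hat_denominator_arg f1 f2 \<sigma> \<alpha> x k \<le> 0"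
    by (simp add: mult_nonneg_nonpos)
  with well_defined assms show ?thesis by fastforce
next
  case False
  define d where "d = hat_denominator_arg f1 f2 \<sigma> \<alpha> x k"
  define n where "n = hat_numerator_arg f2 \<sigma> \<alpha> x k"
  have d: "d > 0" and n: "n \<ge> 0" using False well_defined assms by (auto simp: d_def n_def)
  have "rh (k + 1) \<le> sqrt n / (2 * sqrt d)"
    using rh_le[OF assms] False by (simp add: d_def n_def max_def)
  then have "(rh (k + 1))\<^sup>2 \<le> (sqrt n / (2 * sqrt d))\<^sup>2"
    using rh_pos[of "k + 1"] assms by (intro power_mono) auto
  also have "\<dots> = n / (4 * d)" using d n by (simp add: power_divide power_mult_distrib)
  finally show ?thesis using d by (simp add: d_def[symmetric] n_def[symmetric] field_simps)
qed

text \<open>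
  From index 1 on, the iterates \<open>x (k - 1)\<close> and \<open>x k\<close> both have finite objective values, and \<open>W\<close> takes this
  real value.
\<close>

definition W_real :: "int \<Rightarrow> real" where
  "W_real k = (1 - 4 * \<alpha> k * \<sigma> k * ell2 f2 x k * Delta \<sigma> k) / 4 * (norm (x k - x (k - 1)))\<^sup>2
     + \<sigma> (k + 1) / \<sigma> k * \<alpha> (k + 1) * rh (k + 1) * lower_gap (k - 1)
     + \<sigma> k * \<alpha> k * Delta \<sigma> k * lower_gap k
     + \<sigma> k * \<alpha> k * (1 + rh k) * upper_gap (k - 1)"

text \<open>
  The surplus of the coefficient of the upper gap in \<open>W\<close> over the one that is needed to bound the next Lyapunov value.
\<close>

definition gap_weight :: "int \<Rightarrow> real" where
  "gap_weight k = \<sigma> k * \<alpha> k * (1 + rh k) - \<sigma> (k + 1) * \<alpha> (k + 1) * rh (k + 1)"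

lemma W_real_eq:
  assumes "k \<ge> 0"
  shows "W_real k = hat_numerator_arg f2 \<sigma> \<alpha> x k / 4 * (step k)\<^sup>2
     + \<alpha> k * (rh (k + 1))\<^sup>2 * lower_gap (k - 1)
     + \<alpha> k * (1 - \<sigma> k / \<sigma> (k - 1)) * lower_gap k
     + \<sigma> k * \<alpha> k * (1 + rh k) * upper_gap (k - 1)"
proof -
  have pos: "\<sigma> k > 0" "\<alpha> k > 0" "\<sigma> (k - 1) > 0" using sigma_gt_0 alpha_gt_0 assms by auto
  have 1: "\<sigma> k * Delta \<sigma> k = 1 - \<sigma> k / \<sigma> (k - 1)"
    using pos by (simp add: Delta_def right_diff_distrib)
  have 2: "1 - 4 * \<alpha> k * \<sigma> k * ell2 f2 x k * Delta \<sigma> k = hat_numerator_arg f2 \<sigma> \<alpha> x k"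
    unfolding hat_numerator_arg_def 1[symmetric] by (simp only: ac_simps)
  have 3: "\<sigma> (k + 1) / \<sigma> k * \<alpha> (k + 1) * rh (k + 1) = \<alpha> k * (rh (k + 1))\<^sup>2"
    using pos by (simp add: rho_def power2_eq_square)
  have 4: "\<sigma> k * \<alpha> k * Delta \<sigma> k = \<alpha> k * (1 - \<sigma> k / \<sigma> (k - 1))"
    unfolding 1[symmetric] by (simp only: ac_simps)
  show ?thesis
    unfolding W_real_def 2 3 4 by (simp add: step_def norm_minus_commute)
qed

lemma gamma_rh: "k \<ge> 0 \<Longrightarrow> \<sigma> (k + 1) * \<alpha> (k + 1) = rh (k + 1) * (\<sigma> k * \<alpha> k)"
  unfolding rho_def using sigma_gt_0[of k] alpha_gt_0[of k] by simp

lemma gap_weight_nonneg: assumes "k \<ge> 0" shows "0 \<le> gap_weight k"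
proof -
  have pos: "\<sigma> k > 0" "\<alpha> k > 0" "\<sigma> (k - 1) > 0" using sigma_gt_0 alpha_gt_0 assms by auto
  have "(rh (k + 1))\<^sup>2 \<le> \<sigma> k / \<sigma> (k - 1) * (1 + rh k)" by (rule rh_sq_le[OF assms])
  also have "\<dots> \<le> 1 * (1 + rh k)"
    using pos sigma_mono[OF assms] rh_pos[OF assms] by (intro mult_right_mono) auto
  finally have "(\<sigma> k * \<alpha> k) * (rh (k + 1))\<^sup>2 \<le> (\<sigma> k * \<alpha> k) * (1 + rh k)"
    using pos by (intro mult_left_mono) auto
  then show ?thesis
    unfolding gap_weight_def gamma_rh[OF assms] by (simp add: power2_eq_square algebra_simps)
qed

text \<open>
  The Lyapunov inequality.  After division by \<open>\<sigma> k\<close> the iterates are proximal gradient steps with stepsize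
  \<open>\<sigma> k * \<alpha> k\<close> for the upper objective plus \<open>1 / \<sigma> k\<close> times the lower one.  The step to \<open>x (k + 1)\<close> is compared
  with \<open>z\<close> and the step to \<open>x k\<close> with \<open>x (k + 1)\<close>; together they bound the distance to \<open>z\<close> by an inner product of
  the residual at \<open>x k\<close> with the new step.  Young's inequality splits that product.  The squared residual is
  absorbed by the decrease of the objective from \<open>x (k - 1)\<close> to \<open>x k\<close> and, through the stepsize bound, by the
  previous squared step.  The change of weight between the two steps leaves a multiple of the lower objective at
  \<open>x (k + 1)\<close>, minus a curvature term, both of which are part of the next \<open>W\<close>.
\<close>

lemma one_step:
  assumes "k \<ge> 1" "z \<in> X"
  shows "1/2 * (norm (x (k + 1) - z))\<^sup>2 + W_real (k + 1)
    \<le> 1/2 * (norm (x k - z))\<^sup>2 + W_real k - gap_weight k * upper_gap (k - 1)"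
proof -
  define s s' a a' where "s = \<sigma> k" and "s' = \<sigma> (k + 1)" and "a = \<alpha> k" and "a' = \<alpha> (k + 1)"
  define u v w where "u = x (k - 1)" and "v = x k" and "w = x (k + 1)"
  define \<rho> where "\<rho> = rh (k + 1)"
  define \<tau> where "\<tau> = s' / s"
  note defs = s_def s'_def a_def a'_def u_def v_def w_def \<rho>_def
  have pos: "s > 0" "s' > 0" "a > 0" "a' > 0" using sigma_gt_0 alpha_gt_0 assms(1) by (auto simp: defs)
  have kk: "k \<ge> 0" "k + 1 \<ge> 0" "k - 1 \<ge> 0" using assms(1) by auto
  have zC: "z \<in> common_dom" by (rule solutionsD(1)) fact
  have \<tau>: "0 < \<tau>" "\<tau> \<le> 1" "s' = \<tau> * s"
    using pos sigma_mono[of "k + 1"] kk by (auto simp: \<tau>_def defs)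
  have \<rho>: "a' * \<tau> = \<rho> * a" using pos by (simp add: \<tau>_def \<rho>_def rho_def s_def s'_def a_def a'_def)
  \<comment> \<open>the prox step to \<open>w\<close> compared with the solution \<open>z\<close>\<close>
  have P1: "s' * g1_real w + g2_real w + ((1 / a') *\<^sub>R (v - w) - grad_pen (k + 1) v) \<bullet> (z - w) \<le> s' * g1_real z + g2_real z"
    using prox_step_inequality[OF kk(2) zC] by (simp add: defs)
  have P2: "s' * f1 v + f2 v + grad_pen (k + 1) v \<bullet> (z - v) \<le> s' * f1 z + f2 z"
    using tangent_pen[OF kk(2)] by (simp add: defs)
  \<comment> \<open>the previous prox step compared with \<open>w\<close>; scaled by \<open>\<tau>\<close> it trades the upper nonsmooth term at \<open>w\<close> in \<open>P1\<close> for its value at \<open>v\<close>\<close>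
  have P3: "s * g1_real v + g2_real v + ((1 / a) *\<^sub>R (u - v) - grad_pen k u) \<bullet> (w - v) \<le> s * g1_real w + g2_real w"
    using prox_step_inequality[OF kk(1) iterate_in_common_dom[OF kk(2)]] by (simp add: defs)
  \<comment> \<open>pays for evaluating the surplus \<open>(1 - \<tau>)\<close> of the lower objective at \<open>w\<close> instead of \<open>v\<close>\<close>
  have P4: "f2 w + grad f2 w \<bullet> (v - w) \<le> f2 v"
    by (rule tangent2)
  have ell2: "ell2 f2 x (k + 1) * (step (k + 1))\<^sup>2 = (grad f2 v - grad f2 w) \<bullet> (v - w)"
    using ell2_step[of "k + 1"] by (simp add: defs)
  have P3': "s' * g1_real v + \<tau> * g2_real v + \<tau> * (((1 / a) *\<^sub>R (u - v) - grad_pen k u) \<bullet> (w - v)) \<le> s' * g1_real w + \<tau> * g2_real w"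
    using mult_left_mono[OF P3, of \<tau>] \<tau> by (simp add: algebra_simps)
  have G': "grad_pen (k + 1) v = \<tau> *\<^sub>R grad_pen k v + (1 - \<tau>) *\<^sub>R grad f2 v"
    using \<tau>(3) by (simp add: grad_pen_def defs algebra_simps)
  have res: "((1 / a) *\<^sub>R (u - v) - grad_pen k u) = residual k - grad_pen k v"
    by (simp add: residual_def defs)
  have G'_split: "grad_pen (k + 1) v \<bullet> (w - v) + \<tau> * (((1 / a) *\<^sub>R (u - v) - grad_pen k u) \<bullet> (w - v))
      = \<tau> * (residual k \<bullet> (w - v)) + (1 - \<tau>) * (grad f2 v \<bullet> (w - v))"
    unfolding G' res by (simp add: inner_add_left inner_diff_left algebra_simps)
  have G'_zw: "grad_pen (k + 1) v \<bullet> (z - v) - grad_pen (k + 1) v \<bullet> (z - w) = grad_pen (k + 1) v \<bullet> (w - v)"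
    by (simp add: inner_diff_right)
  have "s' * phi1 v + \<tau> * phi2 v + (1 - \<tau>) * (f2 v + grad f2 v \<bullet> (w - v) + g2_real w)
      + (1 / a') * ((v - w) \<bullet> (z - w)) + \<tau> * (residual k \<bullet> (w - v)) \<le> s' * phi1 z + phi2 z"
    using P1 P2 P3' G'_split G'_zw
    by (simp add: phi1_def phi2_def inner_diff_left[of "_ *\<^sub>R _"] algebra_simps)
  moreover have "(1 - \<tau>) * (phi2 w - ell2 f2 x (k + 1) * (step (k + 1))\<^sup>2)
      \<le> (1 - \<tau>) * (f2 v + grad f2 v \<bullet> (w - v) + g2_real w)"
    using \<tau> P4 unfolding ell2
    by (intro mult_left_mono) (auto simp: phi2_def inner_diff_left inner_diff_right)
  ultimately have I1: "s' * upper_gap k + \<tau> * lower_gap k + (1 - \<tau>) * (lower_gap (k + 1) - ell2 f2 x (k + 1) * (step (k + 1))\<^sup>2)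
      + (1 / a') * ((v - w) \<bullet> (z - w)) + \<tau> * (residual k \<bullet> (w - v)) \<le> 0"
    using phi_solution[OF assms(2)] by (simp add: upper_gap_def lower_gap_def defs algebra_simps)
  have I2: "a' * s' * upper_gap k + a' * \<tau> * lower_gap k
      + a' * (1 - \<tau>) * (lower_gap (k + 1) - ell2 f2 x (k + 1) * (step (k + 1))\<^sup>2)
      + (v - w) \<bullet> (z - w) + \<rho> * ((a *\<^sub>R residual k) \<bullet> (w - v)) \<le> 0"
  proof -
    have "a' * (s' * upper_gap k + \<tau> * lower_gap k + (1 - \<tau>) * (lower_gap (k + 1) - ell2 f2 x (k + 1) * (step (k + 1))\<^sup>2)
      + (1 / a') * ((v - w) \<bullet> (z - w)) + \<tau> * (residual k \<bullet> (w - v))) \<le> 0"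
      using I1 pos by (simp add: mult_le_0_iff)
    moreover have "a' * (\<tau> * (residual k \<bullet> (w - v))) = \<rho> * ((a *\<^sub>R residual k) \<bullet> (w - v))"
      using arg_cong[OF \<rho>, of "\<lambda>r. r * (residual k \<bullet> (w - v))"] by (simp add: mult.assoc)
    moreover have "a' * ((1 / a') * ((v - w) \<bullet> (z - w))) = (v - w) \<bullet> (z - w)" using pos by simp
    ultimately show ?thesis by (simp only: distrib_left mult.assoc)
  qed
  have step': "(step (k + 1))\<^sup>2 = (norm (w - v))\<^sup>2"
    by (simp add: step_def defs norm_minus_commute)
  have three_point: "(v - w) \<bullet> (z - w)
      = 1/2 * (step (k + 1))\<^sup>2 + 1/2 * (norm (w - z))\<^sup>2 - 1/2 * (norm (v - z))\<^sup>2"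
    unfolding step' by (simp add: power2_norm_eq_inner inner_diff_left inner_diff_right inner_commute field_simps)
  \<comment> \<open>Young's inequality with the weight that leaves \<open>1/4\<close> of the squared step on the left-hand side\<close>
  have young: "- (1/4 * (step (k + 1))\<^sup>2) - \<rho>\<^sup>2 * (norm (a *\<^sub>R residual k))\<^sup>2
      \<le> \<rho> * ((a *\<^sub>R residual k) \<bullet> (w - v))"
  proof -
    have "0 \<le> (norm (\<rho> *\<^sub>R (a *\<^sub>R residual k) + (1/2) *\<^sub>R (w - v)))\<^sup>2" by simp
    also have "\<dots> = \<rho>\<^sup>2 * (norm (a *\<^sub>R residual k))\<^sup>2 + \<rho> * ((a *\<^sub>R residual k) \<bullet> (w - v)) + 1/4 * (norm (w - v))\<^sup>2"
      unfolding power2_norm_eq_inner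
      by (simp add: inner_add_left inner_add_right inner_commute power2_eq_square algebra_simps)
    finally show ?thesis unfolding step' by linarith
  qed
  \<comment> \<open>convexity of the previous penalized objective between \<open>v\<close> and \<open>u\<close>\<close>
  have prev: "(1 - a * ell f1 f2 \<sigma> x k) * (step k)\<^sup>2
      \<le> a * s * (upper_gap (k - 1) - upper_gap k) + a * (lower_gap (k - 1) - lower_gap k)"
  proof -
    have "residual k \<bullet> (u - v) \<le> s * (upper_gap (k - 1) - upper_gap k) + (lower_gap (k - 1) - lower_gap k)"
      using residual_subgradient[OF kk(1) iterate_in_common_dom[OF kk(3)]]
      by (simp add: upper_gap_def lower_gap_def defs algebra_simps)
    then have "a * (residual k \<bullet> (u - v)) \<le> a * (s * (upper_gap (k - 1) - upper_gap k) + (lower_gap (k - 1) - lower_gap k))"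
      using pos by (intro mult_left_mono) auto
    then show ?thesis
      using residual_inner_step[OF kk(1)] by (simp add: defs algebra_simps)
  qed
  have residual_bound: "\<rho>\<^sup>2 * (norm (a *\<^sub>R residual k))\<^sup>2
    \<le> \<rho>\<^sup>2 * (a * s * (upper_gap (k - 1) - upper_gap k) + a * (lower_gap (k - 1) - lower_gap k))
      + hat_numerator_arg f2 \<sigma> \<alpha> x k / 4 * (step k)\<^sup>2"
  proof -
    have "\<rho>\<^sup>2 * (norm (a *\<^sub>R residual k))\<^sup>2 = \<rho>\<^sup>2 * ((1 - a * ell f1 f2 \<sigma> x k) * (step k)\<^sup>2)
        + (\<rho>\<^sup>2 * hat_denominator_arg f1 f2 \<sigma> \<alpha> x k) * (step k)\<^sup>2"
      unfolding a_def residual_norm_sq[OF kk(1)] by (simp add: algebra_simps)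
    also have "\<dots> \<le> \<rho>\<^sup>2 * (a * s * (upper_gap (k - 1) - upper_gap k) + a * (lower_gap (k - 1) - lower_gap k))
      + hat_numerator_arg f2 \<sigma> \<alpha> x k / 4 * (step k)\<^sup>2"
      using rh_sq_denominator_le[OF kk(1)] prev unfolding \<rho>_def
      by (intro add_mono mult_left_mono mult_right_mono) auto
    finally show ?thesis .
  qed
  have gam: "a' * s' = \<rho> * (a * s)" using gamma_rh[OF kk(1)] by (simp add: defs mult.commute)
  have main: "1/2 * (norm (w - z))\<^sup>2 + 1/4 * (step (k + 1))\<^sup>2
      - a' * (1 - \<tau>) * ell2 f2 x (k + 1) * (step (k + 1))\<^sup>2
      + a' * s' * (1 + \<rho>) * upper_gap k + a' * \<tau> * (1 + \<rho>) * lower_gap k + a' * (1 - \<tau>) * lower_gap (k + 1)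
    \<le> 1/2 * (norm (v - z))\<^sup>2 + hat_numerator_arg f2 \<sigma> \<alpha> x k / 4 * (step k)\<^sup>2
      + \<rho> * (a' * s') * upper_gap (k - 1) + a * \<rho>\<^sup>2 * lower_gap (k - 1)"
    using I2 young residual_bound unfolding three_point gam \<rho>
    by (simp add: power2_eq_square algebra_simps)
  \<comment> \<open>the bound on the next stepsize ratio makes the coefficient of the lower gap at \<open>v\<close> large enough for the second term of the next \<open>W\<close>\<close>
  have "(rh (k + 2))\<^sup>2 \<le> \<tau> * (1 + \<rho>)"
    using rh_sq_le[OF kk(2)] by (simp add: \<tau>_def defs add.assoc)
  then have "a' * (rh (k + 2))\<^sup>2 * lower_gap k \<le> a' * (\<tau> * (1 + \<rho>)) * lower_gap k"
    using pos lower_gap_nonneg[OF kk(1)] by (intro mult_right_mono mult_left_mono) auto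
  moreover have "0 \<le> a * (1 - s / \<sigma> (k - 1)) * lower_gap k"
    using pos sigma_mono[OF kk(1)] sigma_gt_0[of "k - 1"] kk lower_gap_nonneg[OF kk(1)]
    by (intro mult_nonneg_nonneg) (auto simp: defs divide_simps)
  moreover have "W_real (k + 1) = 1/4 * (step (k + 1))\<^sup>2
      - a' * (1 - \<tau>) * ell2 f2 x (k + 1) * (step (k + 1))\<^sup>2 + a' * (rh (k + 2))\<^sup>2 * lower_gap k
      + a' * (1 - \<tau>) * lower_gap (k + 1) + a' * s' * (1 + \<rho>) * upper_gap k"
  proof -
    have "W_real (k + 1) = (1 - 4 * (1 - \<tau>) * a' * ell2 f2 x (k + 1)) / 4 * (step (k + 1))\<^sup>2
        + a' * (rh (k + 2))\<^sup>2 * lower_gap k + a' * (1 - \<tau>) * lower_gap (k + 1) + s' * a' * (1 + \<rho>) * upper_gap k"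
      unfolding W_real_eq[OF kk(2)] hat_numerator_arg_def by (simp add: defs \<tau>_def add.assoc)
    then show ?thesis by (simp add: field_simps)
  qed
  moreover have "W_real k - gap_weight k * upper_gap (k - 1) = hat_numerator_arg f2 \<sigma> \<alpha> x k / 4 * (step k)\<^sup>2
      + a * \<rho>\<^sup>2 * lower_gap (k - 1) + a * (1 - s / \<sigma> (k - 1)) * lower_gap k + \<rho> * (a' * s') * upper_gap (k - 1)"
    unfolding W_real_eq[OF kk(1)] gap_weight_def by (simp add: defs algebra_simps)
  ultimately show ?thesis
    using main unfolding v_def[symmetric] w_def[symmetric] by (simp add: mult.assoc)
qed

end

section \<open>Limits and rates\<close>

text \<open>
  The two notions of distance differ only for the empty set; the real-valued one is attained on closed sets.
\<close>

lemma edist_set_eq_infdist: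
  fixes S :: "'a::euclidean_space set"
  assumes "closed S" "S \<noteq> {}"
  shows "edist_set y S = ereal (infdist y S)"
proof (rule antisym)
  obtain z where "z \<in> S" "infdist y S = dist y z"
    using infdist_attains_inf[OF assms] by blast
  then show "edist_set y S \<le> ereal (infdist y S)"
    unfolding edist_set_def by (intro INF_lower2[of z]) (auto simp: dist_norm norm_minus_commute)
  show "ereal (infdist y S) \<le> edist_set y S"
    unfolding edist_set_def
    by (intro INF_greatest) (metis dist_commute dist_norm ereal_less_eq(3) infdist_le)
qed

lemma LIMSEQ_int_shift:
  fixes h :: "int \<Rightarrow> real"
  shows "(\<lambda>n. h (int n + int m)) \<longlonglongrightarrow> l \<longleftrightarrow> (\<lambda>n. h (int n)) \<longlonglongrightarrow> l"
  using LIMSEQ_ignore_initial_segment[of "\<lambda>n. h (int n)" l m]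
    LIMSEQ_offset[of "\<lambda>n. h (int n)" m l] by auto

text \<open>
  Since \<open>D\<close> is bounded below and the weights \<open>c\<close> have unbounded sums, the second alternative of \<open>step\<close> cannot hold
  forever, so \<open>D\<close> falls to \<open>\<eta>\<close> at some index; it stays there because neither alternative leads back above
  \<open>\<eta>\<close>.
\<close>

lemma eventually_le_of_decrease:
  fixes D c :: "nat \<Rightarrow> real"
  assumes c: "\<And>n. N \<le> n \<Longrightarrow> 0 \<le> c n" and "\<delta> > 0"
    and unbounded: "\<And>M. \<exists>n\<ge>N. M \<le> (\<Sum>i\<in>{N..<n}. c i)"
    and low: "\<And>n. N \<le> n \<Longrightarrow> - K \<le> D n"
    and step: "\<And>n. N \<le> n \<Longrightarrow> D (Suc n) \<le> \<eta> \<or> D (Suc n) \<le> D n - c n * \<delta>"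
  shows "eventually (\<lambda>n. D n \<le> \<eta>) sequentially"
proof -
  have "\<exists>n\<ge>N. D n \<le> \<eta>"
  proof (rule ccontr)
    assume "\<not> (\<exists>n\<ge>N. D n \<le> \<eta>)"
    then have big: "\<eta> < D n" if "N \<le> n" for n using that by (meson not_le)
    have sum: "D n \<le> D N - (\<Sum>i\<in>{N..<n}. c i) * \<delta>" if "N \<le> n" for n
      using that
    proof (induction n rule: dec_induct)
      case (step n)
      have "D (Suc n) \<le> D n - c n * \<delta>"
        using assms(5)[OF step(1)] big[of "Suc n"] step(1) by auto
      with step show ?case by (simp add: algebra_simps)
    qed simp
    obtain n where n: "n \<ge> N" "(D N + K + 1) / \<delta> \<le> (\<Sum>i\<in>{N..<n}. c i)"
      using unbounded by blast
    then have "D N + K + 1 \<le> (\<Sum>i\<in>{N..<n}. c i) * \<delta>"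
      using \<open>\<delta> > 0\<close> by (simp add: divide_le_eq)
    with sum[OF n(1)] low[OF n(1)] show False by linarith
  qed
  then obtain n0 where n0: "n0 \<ge> N" "D n0 \<le> \<eta>" by blast
  have "D n \<le> \<eta>" if "n0 \<le> n" for n
    using that
  proof (induction n rule: dec_induct)
    case (step n)
    have "N \<le> n" using step n0 by simp
    then have "0 \<le> c n * \<delta>" using c \<open>\<delta> > 0\<close> by simp
    with assms(5)[OF \<open>N \<le> n\<close>] step show ?case by linarith
  qed (rule n0)
  then show ?thesis unfolding eventually_sequentially by blast
qed

context bilevel_iterates
begin

text \<open>
  A common bound for the coefficients of the objective terms in \<open>W_real\<close>.
\<close>

definition W_factor :: real where "W_factor = \<alpha>max * (1 + \<alpha>max / \<alpha>min)"

lemma alpha_max_pos: "0 < \<alpha>max" using params by simp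

lemma W_factor_pos: "0 < W_factor"
  unfolding W_factor_def using params alpha_max_pos by (intro mult_pos_pos add_pos_nonneg) auto

text \<open>
  The index starts at 2 because \<open>rho \<sigma> \<alpha> 1\<close> involves \<open>\<alpha> 0\<close>, which the bounds \<open>\<alpha>min\<close> and \<open>\<alpha>max\<close> do not
  cover.
\<close>

lemma rh_bound:
  assumes "k \<ge> 2" shows "rh k \<le> \<alpha>max / \<alpha>min"
proof -
  have s: "0 < \<sigma> k" "\<sigma> k \<le> \<sigma> (k - 1)" using sigma_gt_0 sigma_mono assms by auto
  have a: "0 < \<alpha> k" "\<alpha> k \<le> \<alpha>max" "\<alpha>min \<le> \<alpha> (k - 1)" using alpha_gt_0 alpha_bounds assms by auto
  have "rh k = (\<sigma> k / \<sigma> (k - 1)) * (\<alpha> k / \<alpha> (k - 1))" by (simp add: rho_def)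
  also have "\<dots> \<le> 1 * (\<alpha>max / \<alpha>min)"
    using s a params by (intro mult_mono frac_le) auto
  finally show ?thesis by simp
qed

lemma scaled_upper_gap_bound:
  assumes "k \<ge> 0"
  shows "\<bar>\<sigma> k * upper_gap k\<bar> \<le> merit k - lower_gap k + \<sigma> k * (opt - inf1)"
proof -
  have "0 \<le> \<sigma> k * (phi1 (x k) - inf1)" "0 \<le> \<sigma> k * (opt - inf1)"
    using sigma_gt_0[of k] inf1_le[OF iterate_in_common_dom[OF assms]] inf1_le_opt assms by auto
  then show ?thesis unfolding merit_def upper_gap_def by (simp add: algebra_simps abs_le_iff)
qed

text \<open>
  The point of this estimate is that it holds before the iterates are known to be bounded: the upper gap occurs in
  \<open>W_real\<close> only with a factor of order \<open>\<sigma> (k - 1)\<close>, and \<open>\<sigma> (k - 1) * upper_gap (k - 1)\<close> is controlled by the merit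
  value.
\<close>

lemma W_real_abs_le:
  assumes "k \<ge> 2"
  shows "\<bar>W_real k\<bar> \<le> 1/4 * (step k)\<^sup>2 + W_factor * (merit (k - 1) + merit k + \<sigma> (k - 1) * (opt - inf1))"
proof -
  have kk: "k \<ge> 0" "k - 1 \<ge> 0" "k + 1 \<ge> 2" using assms by auto
  have s: "0 < \<sigma> k" "\<sigma> k \<le> \<sigma> (k - 1)" "0 < \<sigma> (k - 1)" "0 < \<sigma> (k + 1)" "\<sigma> (k + 1) \<le> \<sigma> k"
    using sigma_gt_0 sigma_mono[of k] sigma_mono[of "k + 1"] assms by auto
  have a: "0 < \<alpha> k" "\<alpha> k \<le> \<alpha>max" "0 < \<alpha> (k + 1)" "\<alpha> (k + 1) \<le> \<alpha>max"
    using alpha_gt_0 alpha_bounds assms by auto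
  have q: "0 < rh k" "rh k \<le> \<alpha>max / \<alpha>min" "0 < rh (k + 1)" "rh (k + 1) \<le> \<alpha>max / \<alpha>min"
    using rh_pos rh_bound assms by auto
  have "0 \<le> 1 - \<sigma> k / \<sigma> (k - 1)" using s by simp
  then have "0 \<le> 4 * (1 - \<sigma> k / \<sigma> (k - 1)) * \<alpha> k * ell2 f2 x k"
    using a ell2_nonneg by (intro mult_nonneg_nonneg) auto
  then have num: "0 \<le> hat_numerator_arg f2 \<sigma> \<alpha> x k" "hat_numerator_arg f2 \<sigma> \<alpha> x k \<le> 1"
    using well_defined kk unfolding hat_numerator_arg_def by auto
  have T1: "\<bar>hat_numerator_arg f2 \<sigma> \<alpha> x k / 4 * (step k)\<^sup>2\<bar> \<le> 1/4 * (step k)\<^sup>2"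
    using num by (simp add: abs_mult mult_left_le_one_le)
  have "\<alpha> k * (rh (k + 1))\<^sup>2 = \<sigma> (k + 1) / \<sigma> k * \<alpha> (k + 1) * rh (k + 1)"
    using s a by (simp add: rho_def power2_eq_square)
  also have "\<dots> \<le> 1 * \<alpha>max * (\<alpha>max / \<alpha>min)"
    using s a q by (intro mult_mono) auto
  also have "\<dots> \<le> W_factor" using alpha_max_pos by (simp add: W_factor_def algebra_simps)
  finally have "\<bar>\<alpha> k * (rh (k + 1))\<^sup>2\<bar> \<le> W_factor" using a by (simp add: abs_mult)
  then have T2: "\<bar>\<alpha> k * (rh (k + 1))\<^sup>2 * lower_gap (k - 1)\<bar> \<le> W_factor * lower_gap (k - 1)"
    unfolding abs_mult[of _ "lower_gap (k - 1)"] using lower_gap_nonneg[OF kk(2)] by (simp add: mult_right_mono)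
  have "0 \<le> \<alpha> k * (1 - \<sigma> k / \<sigma> (k - 1))" using a s by simp
  moreover have "\<alpha> k * (1 - \<sigma> k / \<sigma> (k - 1)) \<le> \<alpha>max * 1"
    using a s by (intro mult_mono) auto
  moreover have "\<alpha>max \<le> W_factor" using params by (simp add: W_factor_def algebra_simps)
  ultimately have "\<bar>\<alpha> k * (1 - \<sigma> k / \<sigma> (k - 1))\<bar> \<le> W_factor" by simp
  then have "\<bar>\<alpha> k * (1 - \<sigma> k / \<sigma> (k - 1)) * lower_gap k\<bar> \<le> W_factor * lower_gap k"
    unfolding abs_mult[of _ "lower_gap k"] using lower_gap_nonneg[OF kk(1)] by (simp add: mult_right_mono)
  also have "\<dots> \<le> W_factor * merit k" using lower_gap_le_merit[OF kk(1)] W_factor_pos by simp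
  finally have T3: "\<bar>\<alpha> k * (1 - \<sigma> k / \<sigma> (k - 1)) * lower_gap k\<bar> \<le> W_factor * merit k" .
  define b where "b = \<sigma> k / \<sigma> (k - 1) * (\<alpha> k * (1 + rh k))"
  have b: "0 \<le> b" using s a q by (simp add: b_def)
  have "b \<le> 1 * (\<alpha>max * (1 + \<alpha>max / \<alpha>min))"
    unfolding b_def using s a q by (intro mult_mono) auto
  then have b': "\<bar>b\<bar> \<le> W_factor" using b by (simp add: W_factor_def)
  have "\<sigma> k * \<alpha> k * (1 + rh k) * upper_gap (k - 1) = b * (\<sigma> (k - 1) * upper_gap (k - 1))"
    using s by (simp add: b_def)
  then have "\<bar>\<sigma> k * \<alpha> k * (1 + rh k) * upper_gap (k - 1)\<bar> = \<bar>b\<bar> * \<bar>\<sigma> (k - 1) * upper_gap (k - 1)\<bar>"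
    by (simp only: abs_mult)
  also have "\<dots> \<le> W_factor * (merit (k - 1) - lower_gap (k - 1) + \<sigma> (k - 1) * (opt - inf1))"
    using b' W_factor_pos by (intro mult_mono scaled_upper_gap_bound kk) auto
  finally have T4: "\<bar>\<sigma> k * \<alpha> k * (1 + rh k) * upper_gap (k - 1)\<bar>
      \<le> W_factor * (merit (k - 1) - lower_gap (k - 1) + \<sigma> (k - 1) * (opt - inf1))" .
  have sum4: "\<bar>p + q + r + s\<bar> \<le> \<bar>p\<bar> + \<bar>q\<bar> + \<bar>r\<bar> + \<bar>s\<bar>" for p q r s :: real by linarith
  have "W_factor * (merit (k - 1) + merit k + \<sigma> (k - 1) * (opt - inf1)) = W_factor * lower_gap (k - 1) + W_factor * merit k
      + W_factor * (merit (k - 1) - lower_gap (k - 1) + \<sigma> (k - 1) * (opt - inf1))"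
    by (simp add: algebra_simps)
  then show ?thesis
    unfolding W_real_eq[OF kk(1)] using T1 T2 T3 T4 by (intro order_trans[OF sum4]) linarith
qed

definition step_bound :: real where "step_bound = sqrt (\<alpha>max / (1 - \<nu>) * merit 0)"
definition W_bound :: real where "W_bound = 1/4 * step_bound\<^sup>2 + W_factor * (2 * merit 0 + \<sigma> 0 * (opt - inf1))"

lemma merit_bound: "k \<ge> 0 \<Longrightarrow> merit k \<le> merit 0"
  using merit_le_merit0[of "nat k"] by simp

lemma sigma_bound: "k \<ge> 0 \<Longrightarrow> \<sigma> k \<le> \<sigma> 0"
  using sigma_le_sigma0[of "nat k"] by simp

lemma step_sq_le:
  assumes "k \<ge> 0"
  shows "(step (k + 1))\<^sup>2 \<le> \<alpha>max / (1 - \<nu>) * (merit k - merit (k + 1))"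
proof -
  have "(1 - \<nu>) * (step (k + 1))\<^sup>2 \<le> \<alpha> (k + 1) * (merit k - merit (k + 1))" by (rule merit_descent[OF assms])
  also have "\<dots> \<le> \<alpha>max * (merit k - merit (k + 1))"
    using alpha_bounds[of "k + 1"] merit_decreasing[OF assms] assms by (intro mult_right_mono) auto
  finally show ?thesis using params by (simp add: field_simps)
qed

lemma step_le_step_bound: "k \<ge> 1 \<Longrightarrow> step k \<le> step_bound"
proof -
  assume k: "k \<ge> 1"
  have "(step k)\<^sup>2 \<le> \<alpha>max / (1 - \<nu>) * (merit (k - 1) - merit k)"
    using step_sq_le[of "k - 1"] k by simp
  also have "\<dots> \<le> \<alpha>max / (1 - \<nu>) * merit 0"
    using merit_bound[of "k - 1"] merit_nonneg[of k] k alpha_max_pos params by (intro mult_left_mono) auto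
  finally show ?thesis unfolding step_bound_def by (rule real_le_rsqrt)
qed

lemma step_nonneg: "0 \<le> step k" by (simp add: step_def)

lemma W_real_bounded:
  assumes "k \<ge> 2" shows "\<bar>W_real k\<bar> \<le> W_bound"
proof -
  have "(step k)\<^sup>2 \<le> step_bound\<^sup>2" using step_le_step_bound step_nonneg assms by (intro power_mono) auto
  moreover have "\<sigma> (k - 1) * (opt - inf1) \<le> \<sigma> 0 * (opt - inf1)"
    using sigma_bound[of "k - 1"] inf1_le_opt assms by (intro mult_right_mono) auto
  then have "W_factor * (merit (k - 1) + merit k + \<sigma> (k - 1) * (opt - inf1)) \<le> W_factor * (2 * merit 0 + \<sigma> 0 * (opt - inf1))"
    using merit_bound[of k] merit_bound[of "k - 1"] assms W_factor_pos by (intro mult_left_mono) auto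
  ultimately show ?thesis using W_real_abs_le[OF assms] unfolding W_bound_def by linarith
qed

lemma two_steps: "norm (x (k + 1) - z) \<le> norm (x (k - 1) - z) + step k + step (k + 1)"
proof -
  have "x (k + 1) - z = (x (k - 1) - z) - (x (k - 1) - x k) - (x k - x (k + 1))" by simp
  then show ?thesis
    using norm_triangle_ineq4[of "(x (k - 1) - z) - (x (k - 1) - x k)" "x k - x (k + 1)"]
      norm_triangle_ineq4[of "x (k - 1) - z" "x (k - 1) - x k"]
    unfolding step_def by simp
qed

text \<open>
  The Lyapunov value \<open>U\<close> cannot increase unless \<open>upper_gap (k - 1)\<close> is negative.  In that case \<open>x (k - 1)\<close> lies in
  a bounded sublevel set, so that \<open>x (k + 1)\<close>, two bounded steps later, has a Lyapunov value below a fixed constant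
  anyway.
\<close>

lemma iterates_bounded: "bounded (range (\<lambda>n. x (int n)))"
proof -
  obtain z where z: "z \<in> X" using X_nonempty by blast
  obtain \<rho> where \<rho>: "\<And>y. y \<in> sublevel (merit 0) \<Longrightarrow> norm (y - z) \<le> \<rho>"
    using bounded_sublevel[of "merit 0"] bounded_any_center[of "sublevel (merit 0)" z]
    by (auto simp: dist_norm norm_minus_commute)
  define U where "U = (\<lambda>k. 1/2 * (norm (x k - z))\<^sup>2 + W_real k)"
  \<comment> \<open>the second bound covers an index reached in two steps from a point of \<open>sublevel (merit 0)\<close>\<close>
  define M where "M = max (U 2) (1/2 * (\<rho> + 2 * step_bound)\<^sup>2 + W_bound)"
  have U_le: "U (int n + 2) \<le> M" for n
  proof (induction n)
    case 0
    then show ?case by (simp add: M_def)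
  next
    case (Suc n)
    define k where "k = int n + 2"
    have k: "k \<ge> 2" "int (Suc n) + 2 = k + 1" by (auto simp: k_def)
    show ?case
    proof (cases "upper_gap (k - 1) \<ge> 0")
      case True
      then have "0 \<le> gap_weight k * upper_gap (k - 1)" using gap_weight_nonneg[of k] k by simp
      then have "U (k + 1) \<le> U k" using one_step[of k z] z k unfolding U_def by linarith
      with Suc k show ?thesis by (simp add: k_def)
    next
      case False
      have "x (k - 1) \<in> common_dom" using iterate_in_common_dom k by simp
      moreover have "phi2 (x (k - 1)) \<le> inf2 + merit 0"
        using lower_gap_le_merit[of "k - 1"] merit_bound[of "k - 1"] k by (simp add: lower_gap_def)
      moreover have "phi1 (x (k - 1)) \<le> opt + merit 0"
        using False merit_nonneg[of 0] by (simp add: upper_gap_def)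
      ultimately have "norm (x (k - 1) - z) \<le> \<rho>" by (intro \<rho>) (simp add: mem_sublevel)
      then have "norm (x (k + 1) - z) \<le> \<rho> + 2 * step_bound"
        using two_steps[of k z] step_le_step_bound[of k] step_le_step_bound[of "k + 1"] k by simp
      then have "(norm (x (k + 1) - z))\<^sup>2 \<le> (\<rho> + 2 * step_bound)\<^sup>2" by (intro power_mono) auto
      then have "U (k + 1) \<le> M"
        using W_real_bounded[of "k + 1"] k unfolding U_def M_def by auto
      then show ?thesis unfolding k(2) .
    qed
  qed
  have far: "norm (x (int n + 2) - z) \<le> sqrt (2 * (M + W_bound))" for n
    using U_le[of n] W_real_bounded[of "int n + 2"] unfolding U_def by (intro real_le_rsqrt) auto
  have "range (\<lambda>n. x (int n)) \<subseteq> {x 0, x 1} \<union> cball z (sqrt (2 * (M + W_bound)))"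
  proof
    fix y assume "y \<in> range (\<lambda>n. x (int n))"
    then obtain n where n: "y = x (int n)" by blast
    show "y \<in> {x 0, x 1} \<union> cball z (sqrt (2 * (M + W_bound)))"
    proof (cases "n \<ge> 2")
      case True
      then show ?thesis using far[of "n - 2"] n by (simp add: of_nat_diff dist_norm norm_minus_commute)
    next
      case False
      then have "n = 0 \<or> n = 1" by linarith
      then show ?thesis using n by auto
    qed
  qed
  then show ?thesis
    by (rule bounded_subset[rotated]) auto
qed

definition V :: "'a set" where "V = convex hull (range (\<lambda>n. x (int n)))"

lemma x_in_V: "k \<ge> 0 \<Longrightarrow> x k \<in> V"
proof -
  assume "k \<ge> 0"
  then have "x k = x (int (nat k))" by simp
  moreover have "x (int (nat k)) \<in> V" unfolding V_def by (intro hull_inc rangeI)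
  ultimately show ?thesis by simp
qed

text \<open>
  A locally Lipschitz gradient is Lipschitz on the compact closure of \<open>V\<close>, and the weights never exceed \<open>\<sigma> 0\<close>.
\<close>

lemma modulus_exists:
  obtains L where "\<And>k. k \<ge> 0 \<Longrightarrow> L-lipschitz_on V (grad_pen k)"
proof -
  have "bounded V" unfolding V_def by (rule bounded_convex_hull[OF iterates_bounded])
  then have cpt: "compact (closure V)" by (simp add: compact_closure)
  obtain L1 where "L1-lipschitz_on (closure V) (grad f1)"
    by (rule compact_locally_lipschitz[OF f_lip(1) cpt])
  moreover obtain L2 where "L2-lipschitz_on (closure V) (grad f2)"
    by (rule compact_locally_lipschitz[OF f_lip(2) cpt])
  ultimately have L: "L1-lipschitz_on V (grad f1)" "L2-lipschitz_on V (grad f2)"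
    by (auto intro: lipschitz_on_subset[OF _ closure_subset])
  have "(\<sigma> 0 * L1 + L2)-lipschitz_on V (grad_pen k)" if "k \<ge> 0" for k
  proof -
    have "(\<bar>\<sigma> k\<bar> * L1 + L2)-lipschitz_on V (grad_pen k)"
      unfolding grad_pen_def[abs_def] by (intro lipschitz_on_add lipschitz_on_cmult L)
    moreover have "\<bar>\<sigma> k\<bar> * L1 + L2 \<le> \<sigma> 0 * L1 + L2"
      using sigma_gt_0[of k] sigma_bound[of k] that lipschitz_on_nonneg[OF L(1)]
      by (intro add_right_mono mult_right_mono) auto
    ultimately show ?thesis using lipschitz_on_le by blast
  qed
  then show thesis by (rule that)
qed

lemma residual_le:
  assumes "k \<ge> 1" "L-lipschitz_on V (grad_pen k)"
  shows "norm (residual k) \<le> (1 / \<alpha> k + L) * step k"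
proof -
  have "norm (grad_pen k (x (k - 1)) - grad_pen k (x k)) \<le> L * step k"
    using lipschitz_onD[OF assms(2) x_in_V x_in_V, of "k - 1" k] assms(1)
    by (simp add: dist_norm step_def)
  moreover have "norm ((1 / \<alpha> k) *\<^sub>R (x (k - 1) - x k)) = (1 / \<alpha> k) * step k"
    using alpha_gt_0[of k] assms(1) by (simp add: step_def)
  moreover have "norm (residual k) \<le> norm ((1 / \<alpha> k) *\<^sub>R (x (k - 1) - x k)) + norm (grad_pen k (x (k - 1)) - grad_pen k (x k))"
    unfolding residual_def by (rule norm_triangle_ineq4)
  ultimately show ?thesis by (simp add: distrib_right)
qed

text \<open>
  The squared steps are dominated by the increments of the convergent sequence of merit values.
\<close>

lemma step_tendsto_0: "(\<lambda>n. step (int n + 1)) \<longlonglongrightarrow> 0"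
proof -
  have dec: "decseq (\<lambda>n. merit (int n))"
  proof (rule decseq_SucI)
    show "merit (int (Suc n)) \<le> merit (int n)" for n
      using merit_decreasing[of "int n"] by (simp add: add.commute)
  qed
  have "\<forall>i. 0 \<le> merit (int i)" by (simp add: merit_nonneg)
  with dec obtain e where e: "(\<lambda>n. merit (int n)) \<longlonglongrightarrow> e" "\<forall>i. e \<le> merit (int i)"
    by (rule decseq_convergent)
  have "(\<lambda>n. \<alpha>max / (1 - \<nu>) * (merit (int n) - merit (int n + 1))) \<longlonglongrightarrow> \<alpha>max / (1 - \<nu>) * (e - e)"
    using e(1) LIMSEQ_int_shift[of merit 1 e] by (intro tendsto_intros) auto
  then have lim: "(\<lambda>n. \<alpha>max / (1 - \<nu>) * (merit (int n) - merit (int n + 1))) \<longlonglongrightarrow> 0" by simp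
  have "(\<lambda>n. (step (int n + 1))\<^sup>2) \<longlonglongrightarrow> 0"
    by (rule Lim_null_comparison[OF always_eventually lim], rule allI)
      (use step_sq_le[of "int _"] in simp)
  then have "(\<lambda>n. sqrt ((step (int n + 1))\<^sup>2)) \<longlonglongrightarrow> sqrt 0" by (intro tendsto_intros)
  then show ?thesis by (simp add: step_nonneg)
qed

text \<open>
  By the subgradient inequality at a solution the merit value is at most the residual times a bounded distance, plus a
  multiple of \<open>\<sigma> k\<close>; the residual is Lipschitz-bounded by the step, which tends to 0.
\<close>

lemma merit_tendsto_0: "(\<lambda>n. merit (int n)) \<longlonglongrightarrow> 0"
proof -
  obtain z where z: "z \<in> X" using X_nonempty by blast
  obtain B where B: "\<And>n. dist z (x (int n)) \<le> B"
    using iterates_bounded bounded_any_center[of _ z] by (metis rangeI)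
  obtain L where L: "\<And>k. k \<ge> 0 \<Longrightarrow> L-lipschitz_on V (grad_pen k)" using modulus_exists by blast
  have bound: "merit (int n + 1) \<le> (1 / \<alpha>min + L) * step (int n + 1) * B + \<sigma> (int n + 1) * (opt - inf1)" for n
  proof -
    define k where "k = int n + 1"
    have k: "k \<ge> 1" by (simp add: k_def)
    have "(1 / \<alpha> k + L) * step k \<le> (1 / \<alpha>min + L) * step k"
      using alpha_bounds[of k] params k step_nonneg by (intro mult_right_mono add_right_mono frac_le) auto
    moreover have "L-lipschitz_on V (grad_pen k)" using L k by simp
    ultimately have r: "norm (residual k) \<le> (1 / \<alpha>min + L) * step k"
      using residual_le[OF k] by (meson order_trans)
    have "norm (z - x k) \<le> B" using B[of "nat k"] k by (simp add: dist_norm)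
    then have "norm (residual k) * norm (z - x k) \<le> (1 / \<alpha>min + L) * step k * B"
      using r by (intro mult_mono) (auto intro: order_trans[OF norm_ge_zero])
    then have "- (residual k \<bullet> (z - x k)) \<le> (1 / \<alpha>min + L) * step k * B"
      using Cauchy_Schwarz_ineq2[of "residual k" "z - x k"] by linarith
    moreover have "\<sigma> k * phi1 (x k) + phi2 (x k) + residual k \<bullet> (z - x k) \<le> \<sigma> k * opt + inf2"
      using residual_subgradient[of k z] solutionsD(1)[OF z] phi_solution[OF z] k by simp
    ultimately show ?thesis
      unfolding k_def[symmetric] by (simp add: merit_def lower_gap_def right_diff_distrib)
  qed
  have "(\<lambda>n. (1 / \<alpha>min + L) * step (int n + 1) * B + \<sigma> (int n + 1) * (opt - inf1))
      \<longlonglongrightarrow> (1 / \<alpha>min + L) * 0 * B + 0 * (opt - inf1)"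
    using sigma_lim LIMSEQ_int_shift[of \<sigma> 1 0] by (intro tendsto_intros step_tendsto_0) auto
  then have lim: "(\<lambda>n. (1 / \<alpha>min + L) * step (int n + 1) * B + \<sigma> (int n + 1) * (opt - inf1)) \<longlonglongrightarrow> 0"
    by simp
  have "(\<lambda>n. merit (int n + 1)) \<longlonglongrightarrow> 0"
  proof (rule Lim_null_comparison[OF always_eventually lim], rule allI)
    fix n
    show "norm (merit (int n + 1)) \<le> (1 / \<alpha>min + L) * step (int n + 1) * B + \<sigma> (int n + 1) * (opt - inf1)"
      using bound[of n] merit_nonneg[of "int n + 1"] by simp
  qed
  then show ?thesis using LIMSEQ_int_shift[of merit 1 0] by simp
qed

lemma W_real_tendsto_0: "(\<lambda>n. W_real (int n)) \<longlonglongrightarrow> 0"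
proof -
  have merit: "(\<lambda>n. merit (int n + 1)) \<longlonglongrightarrow> 0" "(\<lambda>n. merit (int n + 2)) \<longlonglongrightarrow> 0"
    using LIMSEQ_int_shift[of merit 1 0] LIMSEQ_int_shift[of merit 2 0] merit_tendsto_0 by auto
  have S: "(\<lambda>n. step (int n + 2)) \<longlonglongrightarrow> 0" "(\<lambda>n. \<sigma> (int n + 1)) \<longlonglongrightarrow> 0"
    using LIMSEQ_int_shift[of step 1 0] LIMSEQ_int_shift[of step 2 0] LIMSEQ_int_shift[of \<sigma> 1 0]
      step_tendsto_0 sigma_lim by auto
  have "(\<lambda>n. 1/4 * (step (int n + 2))\<^sup>2
      + W_factor * (merit (int n + 1) + merit (int n + 2) + \<sigma> (int n + 1) * (opt - inf1)))
    \<longlonglongrightarrow> 1/4 * 0\<^sup>2 + W_factor * (0 + 0 + 0 * (opt - inf1))"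
    by (intro tendsto_intros merit S)
  then have lim: "(\<lambda>n. 1/4 * (step (int n + 2))\<^sup>2
      + W_factor * (merit (int n + 1) + merit (int n + 2) + \<sigma> (int n + 1) * (opt - inf1))) \<longlonglongrightarrow> 0" by simp
  have "(\<lambda>n. W_real (int n + 2)) \<longlonglongrightarrow> 0"
  proof (rule Lim_null_comparison[OF always_eventually lim], rule allI)
    fix n
    have "int n + 2 - 1 = int n + 1" by simp
    then show "norm (W_real (int n + 2)) \<le> 1/4 * (step (int n + 2))\<^sup>2
      + W_factor * (merit (int n + 1) + merit (int n + 2) + \<sigma> (int n + 1) * (opt - inf1))"
      using W_real_abs_le[of "int n + 2"] by (simp add: add.commute)
  qed
  then show ?thesis using LIMSEQ_int_shift[of W_real 2 0] by simp
qed

text \<open>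
  This turns the divergence of the sum of the \<open>\<sigma> k\<close> into divergence of the total decrease available in \<open>one_step\<close>.
\<close>

lemma gap_weight_sum_unbounded:
  assumes "N \<ge> 2"
  shows "\<exists>n\<ge>N. M \<le> (\<Sum>i\<in>{N..<n}. gap_weight (int i))"
proof -
  \<comment> \<open>the weights telescope up to \<open>\<sigma> n * \<alpha> n\<close>, and \<open>p\<close> is the bounded telescoping part\<close>
  define p where "p = (\<lambda>n. \<sigma> (int n) * \<alpha> (int n) * rh (int n))"
  have p: "0 \<le> p n" "p n \<le> \<sigma> 0 * \<alpha>max * (\<alpha>max / \<alpha>min)" if "n \<ge> 2" for n
  proof -
    have pos: "0 < \<sigma> (int n)" "0 < \<alpha> (int n)" "0 < rh (int n)"
      using sigma_gt_0 alpha_gt_0 rh_pos by auto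
    then show "0 \<le> p n" by (simp add: p_def)
    show "p n \<le> \<sigma> 0 * \<alpha>max * (\<alpha>max / \<alpha>min)"
      unfolding p_def using pos sigma_le_sigma0[of n] alpha_bounds[of "int n"] rh_bound[of "int n"] that
        sigma_gt_0[of 0] alpha_max_pos
      by (intro mult_mono) auto
  qed
  have tele: "(\<Sum>i\<in>{N..<n}. gap_weight (int i)) = (\<Sum>i\<in>{N..<n}. \<sigma> (int i) * \<alpha> (int i)) + p N - p n"
    if "N \<le> n" for n
    using that
  proof (induction n rule: dec_induct)
    case (step n)
    then show ?case by (simp add: gap_weight_def p_def add.commute algebra_simps)
  qed simp
  have low: "\<alpha>min * (\<Sum>i\<in>{N..<n}. \<sigma> (int i)) \<le> (\<Sum>i\<in>{N..<n}. \<sigma> (int i) * \<alpha> (int i))" for n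
    unfolding sum_distrib_left
  proof (rule sum_mono)
    fix i assume "i \<in> {N..<n}"
    then have "\<alpha>min \<le> \<alpha> (int i)" "0 < \<sigma> (int i)"
      using alpha_bounds(2)[of "int i"] sigma_gt_0 assms by auto
    then show "\<alpha>min * \<sigma> (int i) \<le> \<sigma> (int i) * \<alpha> (int i)" by (simp add: mult.commute)
  qed
  define T where "T = (M + \<sigma> 0 * \<alpha>max * (\<alpha>max / \<alpha>min)) / \<alpha>min"
  obtain K where K: "K \<ge> N" "T + (\<Sum>i<N. \<sigma> (int i)) \<le> (\<Sum>k\<le>K. \<sigma> (int k))"
    using sigma_sum unfolding filterlim_at_top eventually_sequentially by (meson nat_le_linear)
  have "(\<Sum>k\<le>K. \<sigma> (int k)) = (\<Sum>i<N. \<sigma> (int i)) + (\<Sum>i\<in>{N..<Suc K}. \<sigma> (int i))"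
    unfolding lessThan_Suc_atMost[symmetric] lessThan_atLeast0 using K(1)
    by (intro sum.atLeastLessThan_concat[symmetric]) auto
  with K have "T \<le> (\<Sum>i\<in>{N..<Suc K}. \<sigma> (int i))" by linarith
  then have "\<alpha>min * T \<le> \<alpha>min * (\<Sum>i\<in>{N..<Suc K}. \<sigma> (int i))"
    using params by (intro mult_left_mono) auto
  also note low
  finally have "M + \<sigma> 0 * \<alpha>max * (\<alpha>max / \<alpha>min) \<le> (\<Sum>i\<in>{N..<Suc K}. \<sigma> (int i) * \<alpha> (int i))"
    using params by (simp add: T_def)
  moreover have "N \<le> Suc K" "2 \<le> Suc K" using K assms by auto
  ultimately have "M \<le> (\<Sum>i\<in>{N..<Suc K}. gap_weight (int i))"
    using tele[of "Suc K"] p(1)[OF assms] p(2)[of "Suc K"] by linarith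
  then show ?thesis using \<open>N \<le> Suc K\<close> by blast
qed

text \<open>
  Taking \<open>z\<close> in \<open>one_step\<close> nearest to \<open>x k\<close> makes half the squared distance to the solution set plus \<open>W_real\<close> a
  Lyapunov function \<open>D\<close>.  The upper gap either exceeds a threshold \<open>\<delta>\<close>, and \<open>D\<close> drops by a multiple of the
  weight, or \<open>x (k - 1)\<close> is in \<open>sublevel \<delta>\<close>, because the lower gap is small eventually, and is thus close to the
  solution set.  Since the weights have unbounded sums, \<open>D\<close> is eventually small, and \<open>W_real\<close> vanishes in the limit.
\<close>

lemma infdist_tendsto_0: "(\<lambda>n. infdist (x (int n)) X) \<longlonglongrightarrow> 0"
proof -
  define D where "D = (\<lambda>n. 1/2 * (infdist (x (int n)) X)\<^sup>2 + W_real (int n))"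
  obtain B where B: "\<And>n. norm (x (int n)) \<le> B"
    using iterates_bounded unfolding bounded_iff by auto
  have D_le: "eventually (\<lambda>n. D n \<le> \<eta>) sequentially" if "\<eta> > 0" for \<eta>
  proof -
    \<comment> \<open>distance and two steps below \<open>e\<close> each give a distance below \<open>4 * e\<close>, whose half square is \<open>\<eta> / 2\<close>\<close>
    define e where "e = sqrt \<eta> / 4"
    have e: "e > 0" "e * e = \<eta> / 16" using that by (auto simp: e_def)
    obtain \<delta> where \<delta>: "\<delta> > 0" "\<And>w. w \<in> sublevel \<delta> \<Longrightarrow> norm w \<le> B \<Longrightarrow> infdist w X < e"
      using sublevel_near_solutions[OF e(1), of B] by blast
    have "eventually (\<lambda>n. merit (int n) < \<delta> \<and> step (int n + 1) < e \<and> W_real (int n) < \<eta> / 2) sequentially"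
      using order_tendstoD(2)[OF merit_tendsto_0 \<delta>(1)] order_tendstoD(2)[OF step_tendsto_0 e(1)]
        order_tendstoD(2)[OF W_real_tendsto_0, of "\<eta> / 2"] that
      by (auto intro!: eventually_conj)
    then obtain N0 where N0: "\<And>n. n \<ge> N0 \<Longrightarrow> merit (int n) < \<delta> \<and> step (int n + 1) < e \<and> W_real (int n) < \<eta> / 2"
      unfolding eventually_sequentially by blast
    define N where "N = N0 + 2"
    have step_alt: "D (Suc n) \<le> \<eta> \<or> D (Suc n) \<le> D n - gap_weight (int n) * \<delta>" if n: "N \<le> n" for n
    proof -
      \<comment> \<open>either \<open>x (k - 1)\<close> is close to the solution set, and two short steps do not lead far away, or the upper gap is large and \<open>D\<close> drops\<close>
      define k where "k = int n"
      have k: "k \<ge> 2" "int (Suc n) = k + 1" "k - 1 = int (n - 1)"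
        using n by (auto simp: k_def N_def)
      have n1: "N0 \<le> n - 1" using n by (simp add: N_def)
      show ?thesis
      proof (cases "upper_gap (k - 1) \<le> \<delta>")
        case True
        have "lower_gap (k - 1) \<le> \<delta>"
          using lower_gap_le_merit[of "k - 1"] N0[OF n1] k by auto
        with True have "x (k - 1) \<in> sublevel \<delta>"
          using iterate_in_common_dom[of "k - 1"] k by (simp add: mem_sublevel upper_gap_def lower_gap_def)
        then have "infdist (x (k - 1)) X < e" using \<delta>(2) B k(3) by simp
        moreover obtain z where z: "z \<in> X" "infdist (x (k - 1)) X = dist (x (k - 1)) z"
          using infdist_attains_inf[OF closed_X X_nonempty] by blast
        moreover have "step k < e" "step (k + 1) < e"
          using N0[OF n1] N0[of n] n k by (auto simp: N_def k_def of_nat_diff)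
        ultimately have "norm (x (k + 1) - z) \<le> 4 * e"
          using two_steps[of k z] e(1) by (simp add: dist_norm)
        moreover have "infdist (x (k + 1)) X \<le> norm (x (k + 1) - z)"
          using infdist_le[OF z(1)] by (simp add: dist_norm)
        ultimately have "infdist (x (k + 1)) X \<le> 4 * e" by linarith
        then have "(infdist (x (k + 1)) X)\<^sup>2 \<le> (4 * e)\<^sup>2" by (intro power_mono infdist_nonneg)
        moreover have "(4 * e)\<^sup>2 = \<eta>" using e(2) by (simp add: power2_eq_square)
        moreover have "W_real (k + 1) < \<eta> / 2" using N0[of "Suc n"] n unfolding k(2) by (simp add: N_def)
        ultimately show ?thesis unfolding D_def k(2) by linarith
      next
        case False
        obtain z where z: "z \<in> X" "infdist (x k) X = dist (x k) z"
          using infdist_attains_inf[OF closed_X X_nonempty] by blast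
        have "infdist (x (k + 1)) X \<le> norm (x (k + 1) - z)"
          using infdist_le[OF z(1)] by (simp add: dist_norm)
        then have "(infdist (x (k + 1)) X)\<^sup>2 \<le> (norm (x (k + 1) - z))\<^sup>2"
          by (intro power_mono infdist_nonneg)
        moreover have "gap_weight k * \<delta> \<le> gap_weight k * upper_gap (k - 1)"
          using False gap_weight_nonneg[of k] k by (intro mult_left_mono) auto
        moreover have "(infdist (x k) X)\<^sup>2 = (norm (x k - z))\<^sup>2" using z by (simp add: dist_norm)
        ultimately have "D (Suc n) \<le> D n - gap_weight (int n) * \<delta>"
          using one_step[of k z] z(1) k unfolding D_def k(2) k_def[symmetric] by linarith
        then show ?thesis ..
      qed
    qed
    show ?thesis
    proof (rule eventually_le_of_decrease[where c = "\<lambda>n. gap_weight (int n)" and K = W_bound])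
      show "\<delta> > 0" by (rule \<delta>(1))
      show "\<And>n. N \<le> n \<Longrightarrow> D (Suc n) \<le> \<eta> \<or> D (Suc n) \<le> D n - gap_weight (int n) * \<delta>" by (rule step_alt)
      show "\<And>n. N \<le> n \<Longrightarrow> 0 \<le> gap_weight (int n)" using gap_weight_nonneg by simp
      show "\<And>M. \<exists>n\<ge>N. M \<le> (\<Sum>i\<in>{N..<n}. gap_weight (int i))" by (rule gap_weight_sum_unbounded) (simp add: N_def)
      fix n assume "N \<le> n"
      then have "\<bar>W_real (int n)\<bar> \<le> W_bound" by (intro W_real_bounded) (simp add: N_def)
      then show "- W_bound \<le> D n"
        using zero_le_power2[of "infdist (x (int n)) X"] unfolding D_def by linarith
    qed
  qed
  show ?thesis
  proof (rule order_tendstoI)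
    fix a :: real assume "a < 0"
    then show "eventually (\<lambda>n. a < infdist (x (int n)) X) sequentially"
      by (intro always_eventually allI) (meson infdist_nonneg less_le_trans)
  next
    fix a :: real assume "0 < a"
    then have a8: "0 < a\<^sup>2 / 8" by simp
    then have "- (a\<^sup>2 / 8) < 0" by simp
    then have "eventually (\<lambda>n. D n \<le> a\<^sup>2 / 8 \<and> - (a\<^sup>2 / 8) < W_real (int n)) sequentially"
      by (intro eventually_conj D_le[OF a8] order_tendstoD(1)[OF W_real_tendsto_0])
    then show "eventually (\<lambda>n. infdist (x (int n)) X < a) sequentially"
    proof eventually_elim
      case (elim n)
      have "1/2 * (infdist (x (int n)) X)\<^sup>2 < a\<^sup>2 / 8 + a\<^sup>2 / 8"
        using elim unfolding D_def by linarith
      then have "(infdist (x (int n)) X)\<^sup>2 < a\<^sup>2" using \<open>0 < a\<close> zero_le_power2[of a] by linarith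
      then show ?case using \<open>0 < a\<close> by (simp add: power2_less_imp_less)
    qed
  qed
qed

text \<open>
  Outside \<open>common_dom\<close> the penalized objective is infinite, so the real inequality suffices.
\<close>

lemma residual_mem_subdifferential:
  assumes "k \<ge> 0"
  shows "residual k \<in> subdifferential (phi_pen f1 g1 f2 g2 (\<sigma> k)) (x k)"
proof -
  have s: "\<sigma> k > 0" using sigma_gt_0 assms by simp
  have val: "phi_pen f1 g1 f2 g2 (\<sigma> k) y = ereal (\<sigma> k * phi1 y + phi2 y)" if "y \<in> common_dom" for y
    using that by (simp add: phi_pen_def composite_def f_pen_def g_pen_def g_eq phi1_def phi2_def algebra_simps)
  have "phi_pen f1 g1 f2 g2 (\<sigma> k) (x k) + ereal (residual k \<bullet> (y - x k)) \<le> phi_pen f1 g1 f2 g2 (\<sigma> k) y" for y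
  proof (cases "y \<in> common_dom")
    case True
    then show ?thesis using residual_subgradient[OF assms True] iterate_in_common_dom[OF assms] by (simp add: val)
  next
    case False
    have "g1 y \<noteq> -\<infinity>" "g2 y \<noteq> -\<infinity>" using g_proper unfolding proper_def by auto
    with False s have "phi_pen f1 g1 f2 g2 (\<sigma> k) y = \<infinity>"
      unfolding common_dom_def dom_def phi_pen_def composite_def g_pen_def
      by (cases "g1 y"; cases "g2 y") auto
    then show ?thesis by simp
  qed
  then show ?thesis unfolding subdifferential_def by blast
qed

text \<open>
  The residual bounds the distance, and the squared step that bounds the residual is paid for by the decrease of the
  merit value; this is what the telescoping sum needs.
\<close>

lemma edist_subdifferential_le:
  assumes "k \<ge> 0" "L-lipschitz_on V (grad_pen (k + 1))"
  shows "(edist_set 0 (subdifferential (phi_pen f1 g1 f2 g2 (\<sigma> (k + 1))) (x (k + 1))))\<^sup>2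
    \<le> ereal ((1 + \<alpha>max * L)\<^sup>2 / (\<alpha>min * (1 - \<nu>)) * (merit k - merit (k + 1)))"
proof -
  define S where "S = subdifferential (phi_pen f1 g1 f2 g2 (\<sigma> (k + 1))) (x (k + 1))"
  define a where "a = \<alpha> (k + 1)"
  have a: "0 < a" "\<alpha>min \<le> a" "a \<le> \<alpha>max" using alpha_gt_0 alpha_bounds assms(1) by (auto simp: a_def)
  have L: "0 \<le> L" using assms(2) by (rule lipschitz_on_nonneg)
  have "edist_set 0 S \<le> ereal (norm (residual (k + 1)))"
    unfolding edist_set_def S_def
    using residual_mem_subdifferential[of "k + 1"] assms(1) by (intro INF_lower2) auto
  moreover have "0 \<le> edist_set 0 S"
    unfolding edist_set_def by (intro INF_greatest) simp
  ultimately have "(edist_set 0 S)\<^sup>2 \<le> (ereal (norm (residual (k + 1))))\<^sup>2"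
    unfolding power2_eq_square by (intro ereal_mult_mono) auto
  also have "\<dots> = ereal ((norm (residual (k + 1)))\<^sup>2)" by (simp add: power2_eq_square)
  also have "(norm (residual (k + 1)))\<^sup>2 \<le> (1 + \<alpha>max * L)\<^sup>2 / (\<alpha>min * (1 - \<nu>)) * (merit k - merit (k + 1))"
  proof -
    have "(norm (residual (k + 1)))\<^sup>2 \<le> ((1 / a + L) * step (k + 1))\<^sup>2"
      using residual_le[OF _ assms(2)] assms(1) by (intro power_mono) (auto simp: a_def)
    also have "1 / a + L = (1 + a * L) / a" using a by (simp add: field_simps)
    also have "((1 + a * L) / a * step (k + 1))\<^sup>2 = (1 + a * L)\<^sup>2 / a\<^sup>2 * (step (k + 1))\<^sup>2"
      by (simp add: power_mult_distrib power_divide)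
    also have "\<dots> \<le> (1 + a * L)\<^sup>2 / a\<^sup>2 * (a / (1 - \<nu>) * (merit k - merit (k + 1)))"
      using merit_descent[OF assms(1)] params by (intro mult_left_mono) (auto simp: a_def field_simps)
    also have "\<dots> = (1 + a * L)\<^sup>2 / (a * (1 - \<nu>)) * (merit k - merit (k + 1))"
      using a by (simp add: power2_eq_square)
    also have "\<dots> \<le> (1 + \<alpha>max * L)\<^sup>2 / (\<alpha>min * (1 - \<nu>)) * (merit k - merit (k + 1))"
      using a L params merit_decreasing[OF assms(1)]
      by (intro mult_right_mono frac_le power_mono add_left_mono mult_pos_pos) auto
    finally show ?thesis .
  qed
  finally show ?thesis unfolding S_def by simp
qed

text \<open>
  The decreases of the merit value sum to at most \<open>merit 0\<close>, so one of the first \<open>K + 1\<close> is at most the average.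
\<close>

lemma residual_rate:
  fixes K :: nat
  assumes L: "\<And>k. k \<ge> 0 \<Longrightarrow> L-lipschitz_on V (grad_pen k)"
  shows "Min ((\<lambda>k. (edist_set 0 (subdifferential (phi_pen f1 g1 f2 g2 (\<sigma> (int k + 1))) (x (int k + 1))))\<^sup>2) ` {0..K})
      \<le> ereal ((1 + \<alpha>max * L)\<^sup>2 / (\<alpha>min * (1 - \<nu>) * (real K + 1)) * merit 0)"
proof -
  have tele: "(\<Sum>k\<le>K. merit (int k) - merit (int k + 1)) = merit 0 - merit (int K + 1)"
    by (induction K) (simp_all add: add.commute)
  have "\<exists>k\<le>K. merit (int k) - merit (int k + 1) \<le> merit 0 / (real K + 1)"
  proof (rule ccontr)
    assume "\<not> ?thesis"
    then have "merit 0 / (real K + 1) < merit (int k) - merit (int k + 1)" if "k \<le> K" for k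
      using that by (meson not_le)
    then have "(\<Sum>k\<le>K. merit 0 / (real K + 1)) < (\<Sum>k\<le>K. merit (int k) - merit (int k + 1))"
      by (intro sum_strict_mono) auto
    then show False using tele merit_nonneg[of "int K + 1"] by (simp add: add.commute)
  qed
  then obtain k where k: "k \<le> K" "merit (int k) - merit (int k + 1) \<le> merit 0 / (real K + 1)" by blast
  have "(edist_set 0 (subdifferential (phi_pen f1 g1 f2 g2 (\<sigma> (int k + 1))) (x (int k + 1))))\<^sup>2
      \<le> ereal ((1 + \<alpha>max * L)\<^sup>2 / (\<alpha>min * (1 - \<nu>)) * (merit (int k) - merit (int k + 1)))"
    by (intro edist_subdifferential_le L) auto
  also have "\<dots> \<le> ereal ((1 + \<alpha>max * L)\<^sup>2 / (\<alpha>min * (1 - \<nu>)) * (merit 0 / (real K + 1)))"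
    unfolding ereal_less_eq using k(2) params by (intro mult_left_mono) auto
  also have "\<dots> = ereal ((1 + \<alpha>max * L)\<^sup>2 / (\<alpha>min * (1 - \<nu>) * (real K + 1)) * merit 0)"
    by simp
  finally show ?thesis
    using k(1) by (intro order_trans[OF Min_le]) auto
qed

text \<open>
  For \<open>V\<close> with interior points the modulus for the weight \<open>\<sigma> 0\<close> carries over to the smaller weights by
  \<open>lipschitz_grad_f_pen_mono\<close>; otherwise the definition lists all weights.
\<close>

lemma modulus_on_iterates:
  "modulus_on f1 f2 (\<lambda>n. \<sigma> (int n)) V L \<longleftrightarrow> (\<forall>k\<ge>0. L-lipschitz_on V (grad_pen k))"
proof
  assume m: "modulus_on f1 f2 (\<lambda>n. \<sigma> (int n)) V L"
  have conv: "convex V" unfolding V_def by (rule convex_convex_hull)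
  have "L-lipschitz_on V (grad_pen (int n))" for n
  proof (cases "interior V = {}")
    case True
    then show ?thesis using m unfolding modulus_on_def grad_pen_def[abs_def] by simp
  next
    case False
    have "L-lipschitz_on V (\<lambda>y. \<sigma> (int n) *\<^sub>R grad f1 y + grad f2 y)"
      by (rule lipschitz_grad_f_pen_mono[OF f_convex f_diff locally_lipschitz_isCont[OF f_lip(1)]
            locally_lipschitz_isCont[OF f_lip(2)] conv False])
        (use m sigma_gt_0[of "int n"] sigma_le_sigma0[of n] in \<open>auto simp: modulus_on_def\<close>)
    then show ?thesis unfolding grad_pen_def[abs_def] .
  qed
  then show "\<forall>k\<ge>0. L-lipschitz_on V (grad_pen k)" by (metis nonneg_int_cases)
next
  assume "\<forall>k\<ge>0. L-lipschitz_on V (grad_pen k)"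
  then show "modulus_on f1 f2 (\<lambda>n. \<sigma> (int n)) V L"
    unfolding modulus_on_def grad_pen_def[abs_def] by simp
qed

lemma phi_bar_pen_eq: "k \<ge> 0 \<Longrightarrow> phi_bar_pen f1 g1 f2 g2 (\<sigma> k) (x k) = ereal (merit k)"
  unfolding phi_bar_pen_def phi_bar1_def phi_bar2_def
  by (simp add: inf_upper_eq inf_lower_eq composite_eq iterate_in_common_dom merit_def lower_gap_def)

lemma W_eq: "k \<ge> 1 \<Longrightarrow> W f1 g1 f2 g2 \<sigma> \<alpha> x k = ereal (W_real k)"
  unfolding W_def phi_bar2_def W_real_def
  by (simp add: opt_value_eq inf_lower_eq composite_eq iterate_in_common_dom upper_gap_def lower_gap_def)

end

theorem theorem3p5:
  fixes f1 f2 :: "real ^ 'n \<Rightarrow> real"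
    and g1 g2 :: "real ^ 'n \<Rightarrow> ereal"
    and \<sigma> \<alpha> :: "int \<Rightarrow> real"
    and x :: "int \<Rightarrow> real ^ 'n"
    and \<alpha>min \<alpha>max \<nu> :: real
  assumes basic: "basic_assumption f1 g1 f2 g2"
    and sigma_pos: "\<forall>k\<ge>-1. \<sigma> k > 0"
    and alpha_pos: "\<forall>k\<ge>-1. \<alpha> k > 0"
    and sigma_init: "\<sigma> 0 \<le> \<sigma> (-1)"
    and iterates: "prox_grad_iterates f1 g1 f2 g2 \<sigma> \<alpha> x"
    and params: "\<alpha>max \<ge> \<alpha>min" "\<alpha>min > 0" "0 < \<nu>" "\<nu> < 1"
    and well_defined: "\<forall>k\<ge>0. hat_numerator_arg f2 \<sigma> \<alpha> x k \<ge> 0"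
    and step_upper: "\<forall>k\<ge>0. ereal (\<alpha> (k + 1)) \<le> min (alpha_hat_next f1 f2 \<sigma> \<alpha> x k) (ereal \<alpha>max)"
    and step_curv: "\<forall>k\<ge>0. \<alpha> (k + 1) * ell f1 f2 \<sigma> x (k + 1) \<le> \<nu>"
    and step_lower: "\<forall>k\<ge>0. \<alpha> (k + 1) \<ge> \<alpha>min"
    and sigma_decr: "\<forall>k\<ge>0. 0 < \<sigma> (k + 1) \<and> \<sigma> (k + 1) \<le> \<sigma> k"
    and sigma_lim: "(\<lambda>k::nat. \<sigma> (int k)) \<longlonglongrightarrow> 0"
    and sigma_sum: "filterlim (\<lambda>K::nat. \<Sum>k\<le>K. \<sigma> (int k)) at_top sequentially"
  defines "V \<equiv> convex hull (range (\<lambda>k::nat. x (int k)))"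
  shows "bounded (range (\<lambda>k::nat. x (int k)))
    \<and> (\<lambda>k::nat. edist_set (x (int k)) (solutions f1 g1 f2 g2)) \<longlonglongrightarrow> 0
    \<and> (\<lambda>k::nat. phi_bar_pen f1 g1 f2 g2 (\<sigma> (int k)) (x (int k))) \<longlonglongrightarrow> 0
    \<and> (\<lambda>k::nat. W f1 g1 f2 g2 \<sigma> \<alpha> x (int k)) \<longlonglongrightarrow> 0
    \<and> (\<exists>L. modulus_on f1 f2 (\<lambda>k. \<sigma> (int k)) V L)
    \<and> (\<forall>L. modulus_on f1 f2 (\<lambda>k. \<sigma> (int k)) V L \<longrightarrow>
         (\<forall>K::nat.
           Min ((\<lambda>k. (edist_set 0 (subdifferential (phi_pen f1 g1 f2 g2 (\<sigma> (int k + 1))) (x (int k + 1))))\<^sup>2) ` {0..K})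
           \<le> ereal ((1 + \<alpha>max * L)\<^sup>2 / (\<alpha>min * (1 - \<nu>) * (real K + 1)))
               * phi_bar_pen f1 g1 f2 g2 (\<sigma> 0) (x 0)))"
proof -
  interpret it: bilevel_iterates f1 f2 g1 g2 \<sigma> \<alpha> x \<alpha>min \<alpha>max \<nu>
    using assms by unfold_locales auto
  have V: "V = it.V" unfolding V_def it.V_def ..
  have zero: "(0::ereal) = ereal 0" by simp
  show ?thesis
  proof (intro conjI allI impI)
    show "bounded (range (\<lambda>k::nat. x (int k)))" by (rule it.iterates_bounded)
    show "(\<lambda>k::nat. edist_set (x (int k)) (solutions f1 g1 f2 g2)) \<longlonglongrightarrow> 0"
      unfolding edist_set_eq_infdist[OF it.closed_X it.X_nonempty] zero
      by (intro tendsto_ereal it.infdist_tendsto_0)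
    show "(\<lambda>k::nat. phi_bar_pen f1 g1 f2 g2 (\<sigma> (int k)) (x (int k))) \<longlonglongrightarrow> 0"
      unfolding zero by (simp add: it.phi_bar_pen_eq it.merit_tendsto_0)
    have "(\<lambda>k::nat. ereal (it.W_real (int k))) \<longlonglongrightarrow> 0"
      unfolding zero by (intro tendsto_ereal it.W_real_tendsto_0)
    moreover have "eventually (\<lambda>k::nat. W f1 g1 f2 g2 \<sigma> \<alpha> x (int k) = ereal (it.W_real (int k))) sequentially"
      using eventually_ge_at_top[of 1] by eventually_elim (simp add: it.W_eq)
    ultimately show "(\<lambda>k::nat. W f1 g1 f2 g2 \<sigma> \<alpha> x (int k)) \<longlonglongrightarrow> 0"
      by (simp cong: tendsto_cong)
    show "\<exists>L. modulus_on f1 f2 (\<lambda>k. \<sigma> (int k)) V L"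
      using it.modulus_exists unfolding V it.modulus_on_iterates by metis
  next
    fix L :: real and K :: nat
    assume "modulus_on f1 f2 (\<lambda>k. \<sigma> (int k)) V L"
    then have "\<And>k. k \<ge> 0 \<Longrightarrow> L-lipschitz_on it.V (it.grad_pen k)"
      unfolding V it.modulus_on_iterates by blast
    from it.residual_rate[OF this, of K]
    show "Min ((\<lambda>k. (edist_set 0 (subdifferential (phi_pen f1 g1 f2 g2 (\<sigma> (int k + 1))) (x (int k + 1))))\<^sup>2) ` {0..K})
        \<le> ereal ((1 + \<alpha>max * L)\<^sup>2 / (\<alpha>min * (1 - \<nu>) * (real K + 1)))
            * phi_bar_pen f1 g1 f2 g2 (\<sigma> 0) (x 0)"
      by (simp add: it.phi_bar_pen_eq)
  qed
qed

end
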